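(* Let $\mathcal H$ be a complex Hilbert space, $T\in\boldsymbol B(\mathcal H)$ a class A operator, and $n,\kappa$ integers greater than $1$. If $X=T^n$ satisfies $X^{*\kappa}X^\kappa=(X^*X)^\kappa$, then $T$ is quasinormal.
   Context: An operator $T\in\boldsymbol B(\mathcal H)$ is of class A if $T^*T\le(T^{*2}T^2)^{1/2}$, and quasinormal if $T(T^*T)=(T^*T)T$. *)

theory Defs
  imports "HOL-Analysis.Analysis"
begin

text \<open>Convention: the inner product is conjugate-linear in the first argument
  and linear in the second.\<close>

class complex_inner = real_normed_vector +
  fixes scaleC :: "complex \<Rightarrow> 'a \<Rightarrow> 'a" (infixr \<open>*\<^sub>C\<close> 75)
    and cinner :: "'a \<Rightarrow> 'a \<Rightarrow> complex"
  assumes scaleC_add_right: "a *\<^sub>C (x + y) = a *\<^sub>C x + a *\<^sub>C y"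
    and scaleC_add_left: "(a + b) *\<^sub>C x = a *\<^sub>C x + b *\<^sub>C x"
    and scaleC_scaleC: "a *\<^sub>C (b *\<^sub>C x) = (a * b) *\<^sub>C x"
    and scaleC_one: "1 *\<^sub>C x = x"
    and scaleR_scaleC: "scaleR r x = complex_of_real r *\<^sub>C x"
    and cinner_commute: "cinner x y = cnj (cinner y x)"
    and cinner_add_left: "cinner (x + y) z = cinner x z + cinner y z"
    and cinner_scaleC_left: "cinner (a *\<^sub>C x) y = cnj a * cinner x y"
    and cinner_ge_zero: "0 \<le> Re (cinner x x)"
    and cinner_eq_zero_iff: "cinner x x = 0 \<longleftrightarrow> x = 0"
    and norm_eq_sqrt_cinner: "norm x = sqrt (Re (cinner x x))"

class chilbert_space = complex_inner + complete_space

text \<open>The complex numbers themselves form a complex Hilbert space (non-vacuity).\<close>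

instantiation complex :: chilbert_space
begin
definition scaleC_complex :: "complex \<Rightarrow> complex \<Rightarrow> complex" where
  "scaleC_complex a x = a * x"
definition cinner_complex :: "complex \<Rightarrow> complex \<Rightarrow> complex" where
  "cinner_complex x y = cnj x * y"
instance
proof
  fix a b :: complex and x y z :: complex and r :: real
  show "a *\<^sub>C (x + y) = a *\<^sub>C x + a *\<^sub>C y" by (simp add: scaleC_complex_def algebra_simps)
  show "(a + b) *\<^sub>C x = a *\<^sub>C x + b *\<^sub>C x" by (simp add: scaleC_complex_def algebra_simps)
  show "a *\<^sub>C (b *\<^sub>C x) = (a * b) *\<^sub>C x" by (simp add: scaleC_complex_def algebra_simps)
  show "1 *\<^sub>C x = x" by (simp add: scaleC_complex_def)
  show "scaleR r x = complex_of_real r *\<^sub>C x" by (simp add: scaleC_complex_def scaleR_conv_of_real)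
  show "cinner x y = cnj (cinner y x)" by (simp add: cinner_complex_def)
  show "cinner (x + y) z = cinner x z + cinner y z" by (simp add: cinner_complex_def algebra_simps)
  show "cinner (a *\<^sub>C x) y = cnj a * cinner x y" by (simp add: cinner_complex_def scaleC_complex_def)
  show "0 \<le> Re (cinner x x)" by (simp add: cinner_complex_def)
  show "cinner x x = 0 \<longleftrightarrow> x = 0" by (simp add: cinner_complex_def)
  show "norm x = sqrt (Re (cinner x x))"
    by (simp add: cinner_complex_def cmod_def power2_eq_square)
qed
end

definition bounded_clinear :: "('a::complex_inner \<Rightarrow> 'b::complex_inner) \<Rightarrow> bool" where
  "bounded_clinear T \<longleftrightarrow>
     (\<forall>x y. T (x + y) = T x + T y) \<and> (\<forall>a x. T (a *\<^sub>C x) = a *\<^sub>C T x) \<and>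
     (\<exists>K. \<forall>x. norm (T x) \<le> norm x * K)"

definition adj :: "('a::complex_inner \<Rightarrow> 'a) \<Rightarrow> ('a \<Rightarrow> 'a)" where
  "adj T = (THE S. \<forall>x y. cinner (T x) y = cinner x (S y))"

definition positive_op :: "('a::complex_inner \<Rightarrow> 'a) \<Rightarrow> bool" where
  "positive_op A \<longleftrightarrow> (\<forall>x. Im (cinner x (A x)) = 0 \<and> 0 \<le> Re (cinner x (A x)))"

definition op_le :: "('a::complex_inner \<Rightarrow> 'a) \<Rightarrow> ('a \<Rightarrow> 'a) \<Rightarrow> bool" where
  "op_le A B \<longleftrightarrow> positive_op (\<lambda>x. B x - A x)"

definition op_sqrt :: "('a::complex_inner \<Rightarrow> 'a) \<Rightarrow> ('a \<Rightarrow> 'a)" where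
  "op_sqrt A = (THE S. bounded_clinear S \<and> positive_op S \<and> S \<circ> S = A)"

definition class_A :: "('a::complex_inner \<Rightarrow> 'a) \<Rightarrow> bool" where
  "class_A T \<longleftrightarrow> op_le (adj T \<circ> T) (op_sqrt ((adj T ^^ 2) \<circ> (T ^^ 2)))"

definition quasinormal :: "('a::complex_inner \<Rightarrow> 'a) \<Rightarrow> bool" where
  "quasinormal T \<longleftrightarrow> T \<circ> (adj T \<circ> T) = (adj T \<circ> T) \<circ> T"

end

theory Submission
  imports Defs
begin

text \<open>
  Write \<open>A\<^sub>k = T*\<^sup>k T\<^sup>k\<close>. The class A condition says that \<open>A\<^sub>1\<close> is at most the geometric mean of
  \<open>A\<^sub>0\<close> and \<open>A\<^sub>2\<close>; conjugating by \<open>T\<^sup>k\<close>, every \<open>A\<^sub>k\<^sub>+\<^sub>1\<close> is at most the geometric mean of \<open>A\<^sub>k\<close> and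
  \<open>A\<^sub>k\<^sub>+\<^sub>2\<close>. Let \<open>D\<close> be the \<open>n\<close>-th root of \<open>A\<^sub>n\<close>, so that \<open>A\<^sub>k = D\<^sup>k\<close> for \<open>k = 0, n, n\<kappa>\<close>. By a maximum
  principle this operator log-convexity gives \<open>A\<^sub>k \<le> D\<^sup>k\<close> for \<open>0 \<le> k \<le> n\<kappa>\<close>, and the equality at the
  interior point \<open>n\<close> propagates to all \<open>k\<close>. The equalities for \<open>k = 1, 2, 3\<close> make \<open>T\<close> commute with
  \<open>D = T*T\<close>. Below \<open>R\<close> is the square root of \<open>D\<close>, and \<open>A\<^sub>k \<le> D\<^sup>k\<close> reads \<open>\<parallel>T\<^sup>k x\<parallel> \<le> \<parallel>R\<^sup>k x\<parallel>\<close>.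
\<close>

section \<open>The real inner product\<close>

text \<open>The real part is a symmetric real bilinear form that determines norms and adjoints, so
  most estimates avoid complex conjugates; \<open>cinner_eq_rinner\<close> recovers the complex
  form.\<close>

definition rinner :: "'a::complex_inner \<Rightarrow> 'a \<Rightarrow> real" where
  "rinner x y = Re (cinner x y)"

lemma rinner_commute: "rinner x y = rinner y x"
  unfolding rinner_def by (subst cinner_commute) simp

lemma rinner_add_left: "rinner (x + y) z = rinner x z + rinner y z"
  by (simp add: rinner_def cinner_add_left)

lemma rinner_add_right: "rinner z (x + y) = rinner z x + rinner z y"
  by (metis rinner_add_left rinner_commute)

lemma rinner_scaleR_left: "rinner (r *\<^sub>R x) y = r * rinner x y"
  by (simp add: rinner_def scaleR_scaleC cinner_scaleC_left)

lemma rinner_scaleR_right: "rinner x (r *\<^sub>R y) = r * rinner x y"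
  by (metis rinner_scaleR_left rinner_commute)

lemma rinner_diff_left: "rinner (x - y) z = rinner x z - rinner y z"
  using rinner_add_left[of "x - y" y z] by simp

lemma rinner_diff_right: "rinner z (x - y) = rinner z x - rinner z y"
  by (metis rinner_diff_left rinner_commute)

lemma rinner_zero [simp]: "rinner 0 x = 0" "rinner x 0 = 0"
  using rinner_diff_left[of x x x] rinner_diff_left[of 0 0 x] rinner_diff_right[of x 0 0] by auto

lemmas rinner_simps = rinner_add_left rinner_add_right rinner_diff_left rinner_diff_right
  rinner_scaleR_left rinner_scaleR_right

lemma rinner_self: "rinner x x = (norm x)\<^sup>2"
  by (simp add: rinner_def norm_eq_sqrt_cinner cinner_ge_zero)

lemma rinner_Cauchy_Schwarz: "\<bar>rinner x y\<bar> \<le> norm x * norm y"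
proof (cases "y = 0")
  case False
  define t where "t = rinner x y / (norm y)\<^sup>2"
  have ny: "(norm y)\<^sup>2 > 0" using False by simp
  have "0 \<le> rinner (x - t *\<^sub>R y) (x - t *\<^sub>R y)" by (simp add: rinner_self)
  also have "\<dots> = (norm x)\<^sup>2 - 2 * t * rinner x y + t\<^sup>2 * (norm y)\<^sup>2"
    unfolding rinner_self[symmetric]
    by (simp add: rinner_simps rinner_commute[of y x] power2_eq_square algebra_simps)
  also have "\<dots> = (norm x)\<^sup>2 - (rinner x y)\<^sup>2 / (norm y)\<^sup>2"
    using ny by (simp add: t_def power2_eq_square field_simps)
  finally have "(rinner x y)\<^sup>2 \<le> (norm x * norm y)\<^sup>2"
    using ny by (simp add: field_simps power_mult_distrib)
  then show ?thesis by (simp add: abs_le_square_iff[symmetric] abs_mult)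
qed simp

lemma rinner_eqI:
  assumes "\<And>y. rinner y a = rinner y b"
  shows "a = b"
proof -
  have "rinner (a - b) (a - b) = 0" using assms by (simp add: rinner_diff_right)
  then show ?thesis by (simp add: rinner_self)
qed

lemma bounded_linear_rinner_right: "bounded_linear (rinner x)"
proof (rule bounded_linear_intro[where K = "norm x"])
  show "norm (rinner x y) \<le> norm y * norm x" for y
    using rinner_Cauchy_Schwarz[of x y] by (simp add: mult.commute)
qed (simp_all add: rinner_simps)

lemma bounded_linear_rinner_left: "bounded_linear (\<lambda>x. rinner x y)"
  by (subst rinner_commute) (rule bounded_linear_rinner_right)

lemma cinner_eq_rinner: "cinner x y = Complex (rinner x y) (rinner (\<i> *\<^sub>C x) y)"
  by (simp add: rinner_def cinner_scaleC_left complex_eq_iff)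

lemma bounded_linear_scaleC: "bounded_linear (\<lambda>x::'a::complex_inner. a *\<^sub>C x)"
proof (rule bounded_linear_intro[where K = "cmod a"])
  fix x :: 'a
  have "cinner (a *\<^sub>C x) (a *\<^sub>C x) = cnj a * a * cinner x x"
    by (metis cinner_commute cinner_scaleC_left complex_cnj_cnj complex_cnj_mult mult.assoc)
  also have "cnj a * a = complex_of_real ((cmod a)\<^sup>2)"
    by (metis complex_norm_square mult.commute of_real_power)
  finally have "(norm (a *\<^sub>C x))\<^sup>2 = (norm x * cmod a)\<^sup>2"
    by (simp add: rinner_self[symmetric] rinner_def power_mult_distrib Re_complex_of_real)
  then show "norm (a *\<^sub>C x) \<le> norm x * cmod a"
    by (simp add: power2_eq_iff_nonneg)
qed (simp_all add: scaleC_add_right scaleR_scaleC scaleC_scaleC mult.commute)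

lemma bounded_clinear_imp_bounded_linear: "bounded_clinear T \<Longrightarrow> bounded_linear T"
  unfolding bounded_clinear_def by (auto intro: bounded_linear_intro simp: scaleR_scaleC)

lemma bounded_clinear_scaleC: "bounded_clinear T \<Longrightarrow> T (a *\<^sub>C x) = a *\<^sub>C T x"
  by (simp add: bounded_clinear_def)

lemma bounded_clinearI:
  assumes "bounded_linear T" "\<And>a x. T (a *\<^sub>C x) = a *\<^sub>C T x"
  shows "bounded_clinear T"
  unfolding bounded_clinear_def
  using assms bounded_linear.bounded[OF assms(1)] by (simp add: linear_simps)

section \<open>Adjoints\<close>

text \<open>The quadratic vanishes at \<open>t = 0\<close> and so has its minimum there; its
  derivative \<open>2 * b\<close> must be zero.\<close>

lemma quadratic_nonneg_imp_linear_zero: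
  fixes a b :: real
  assumes "\<And>t. 0 \<le> t\<^sup>2 * a + 2 * t * b" "0 \<le> a"
  shows "b = 0"
proof (rule ccontr)
  assume "b \<noteq> 0"
  \<comment> \<open>The minimiser \<open>- b / a\<close>, with the denominator shifted by 1 to allow
    \<open>a = 0\<close>.\<close>
  have "0 \<le> (- b / (a + 1))\<^sup>2 * a + 2 * (- b / (a + 1)) * b" by (rule assms)
  also have "\<dots> = - (b\<^sup>2 * (a + 2)) / (a + 1)\<^sup>2"
    using assms(2) by (simp add: power2_eq_square divide_simps) (simp add: algebra_simps)
  also have "\<dots> < 0" using \<open>b \<noteq> 0\<close> assms(2) by (simp add: divide_neg_pos)
  finally show False by simp
qed

text \<open>The representing vector minimises the functional \<open>\<parallel>x\<parallel>\<^sup>2 - 2 f x\<close>; the parallelogram law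
  makes a minimising sequence Cauchy.\<close>
lemma riesz_representation:
  fixes f :: "'a::chilbert_space \<Rightarrow> real"
  assumes f: "bounded_linear f"
  shows "\<exists>z. \<forall>x. f x = rinner x z"
proof -
  interpret f: bounded_linear f by fact
  define q where "q x = (norm x)\<^sup>2 - 2 * f x" for x
  obtain K where K: "\<And>x. norm (f x) \<le> norm x * K" using f.bounded by blast
  have lower: "- K\<^sup>2 \<le> q x" for x
  proof -
    have "f x \<le> norm x * K" using K[of x] by simp
    moreover have "0 \<le> (norm x - K)\<^sup>2" by simp
    ultimately show ?thesis unfolding q_def by (simp add: power2_eq_square algebra_simps)
  qed
  have bdd: "bdd_below (range q)" using lower by (auto intro!: bdd_belowI)
  define d where "d = Inf (range q)"
  have d_le: "d \<le> q x" for x unfolding d_def by (rule cInf_lower[OF _ bdd]) simp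
  have "\<exists>x. q x < d + 1 / Suc m" for m
    using cInf_lessD[of "range q" "d + 1 / Suc m"] by (auto simp: d_def)
  then obtain z where z: "\<And>m. q (z m) < d + 1 / Suc m" by metis
  have par: "(norm (x - y))\<^sup>2 \<le> 2 * (q x - d) + 2 * (q y - d)" for x y
  proof -
    have "2 * q x + 2 * q y - 4 * q ((1/2) *\<^sub>R (x + y)) = (norm (x - y))\<^sup>2"
      unfolding q_def rinner_self[symmetric]
      by (simp add: rinner_simps f.add f.scaleR rinner_commute[of y x] algebra_simps)
    with d_le[of "(1/2) *\<^sub>R (x + y)"] show ?thesis by simp
  qed
  have "Cauchy z"
  proof (rule metric_CauchyI)
    fix e :: real assume e: "0 < e"
    obtain M :: nat where M: "4 / e\<^sup>2 < real (Suc M)"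
      by (metis less_Suc_eq of_nat_less_iff order_less_trans reals_Archimedean2)
    have *: "q (z m) - d < e\<^sup>2 / 4" if "m \<ge> M" for m
    proof -
      have "1 / real (Suc m) \<le> 1 / real (Suc M)" using that by (simp add: divide_simps)
      also have "\<dots> < e\<^sup>2 / 4" using M e by (simp add: field_simps)
      finally show ?thesis using z[of m] by simp
    qed
    show "\<exists>M. \<forall>m\<ge>M. \<forall>n\<ge>M. dist (z m) (z n) < e"
    proof (intro exI allI impI)
      fix m n assume "M \<le> m" "M \<le> n"
      then have "(norm (z m - z n))\<^sup>2 < e\<^sup>2" using par[of "z m" "z n"] *[of m] *[of n] by simp
      then show "dist (z m) (z n) < e" using e by (simp add: dist_norm power2_less_imp_less)
    qed
  qed
  then obtain w where w: "z \<longlonglongrightarrow> w" by (auto simp: Cauchy_convergent_iff convergent_def)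
  have "(\<lambda>m. q (z m)) \<longlonglongrightarrow> q w"
    unfolding q_def by (intro tendsto_intros w f.tendsto)
  moreover have "(\<lambda>m. d + 1 / real (Suc m)) \<longlonglongrightarrow> d + 0"
    by (intro tendsto_intros LIMSEQ_Suc[OF lim_1_over_n])
  ultimately have "q w \<le> d + 0"
    by (rule LIMSEQ_le) (use z less_imp_le in blast)
  then have min: "q w \<le> q x" for x using d_le[of x] by simp
  have "f x = rinner x w" for x
  proof -
    \<comment> \<open>First variation of \<open>q\<close> at its minimiser \<open>w\<close>, along
      the line \<open>w + t *\<^sub>R x\<close>.\<close>
    have "rinner w x - f x = 0"
    proof (rule quadratic_nonneg_imp_linear_zero[where a = "(norm x)\<^sup>2"])
      fix t
      have "q (w + t *\<^sub>R x) - q w = t\<^sup>2 * (norm x)\<^sup>2 + 2 * t * (rinner w x - f x)"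
        unfolding q_def rinner_self[symmetric]
        by (simp add: rinner_simps f.add f.scaleR rinner_commute[of x w] power2_eq_square algebra_simps)
      then show "0 \<le> t\<^sup>2 * (norm x)\<^sup>2 + 2 * t * (rinner w x - f x)" using min[of "w + t *\<^sub>R x"] by simp
    qed simp
    then show ?thesis by (simp add: rinner_commute)
  qed
  then show ?thesis by blast
qed

text \<open>\<open>adj\<close> is a definite description, so existence and uniqueness are both
  settled here. Riesz gives an adjoint for the real form; complex linearity of \<open>T\<close>,
  used at \<open>\<i> *\<^sub>C x\<close>, upgrades the identity to \<open>cinner\<close>.\<close>

lemma adj_cinner:
  fixes T :: "'a::chilbert_space \<Rightarrow> 'a"
  assumes T: "bounded_clinear T"
  shows "cinner (T x) y = cinner x (adj T y)"
proof -
  have "\<exists>z. \<forall>x. rinner (T x) y = rinner x z" for y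
    by (rule riesz_representation)
      (rule bounded_linear_compose[OF bounded_linear_rinner_left bounded_clinear_imp_bounded_linear[OF T]])
  then obtain S where S: "\<And>x y. rinner (T x) y = rinner x (S y)" by metis
  have S': "\<forall>x y. cinner (T x) y = cinner x (S y)"
    by (simp add: cinner_eq_rinner S bounded_clinear_scaleC[OF T, symmetric])
  have "adj T = S"
    unfolding adj_def
  proof (rule the_equality, rule S')
    fix S2 assume "\<forall>x y. cinner (T x) y = cinner x (S2 y)"
    then have "rinner x (S2 y) = rinner x (S y)" for x y
      using S'[rule_format, of x y] by (simp add: rinner_def)
    then show "S2 = S" by (intro ext rinner_eqI)
  qed
  with S' show ?thesis by blast
qed

lemma adj_rinner:
  fixes T :: "'a::chilbert_space \<Rightarrow> 'a"
  assumes "bounded_clinear T"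
  shows "rinner (T x) y = rinner x (adj T y)" "rinner y (T x) = rinner (adj T y) x"
  using adj_cinner[OF assms] by (metis rinner_def) (metis adj_cinner[OF assms] rinner_def rinner_commute)

lemma adj_unique:
  fixes T :: "'a::chilbert_space \<Rightarrow> 'a"
  assumes "bounded_clinear T" "\<And>x y. rinner (T x) y = rinner x (S y)"
  shows "adj T = S"
  by (intro ext rinner_eqI) (metis assms adj_rinner(1))

lemma bounded_clinear_adj:
  fixes T :: "'a::chilbert_space \<Rightarrow> 'a"
  assumes T: "bounded_clinear T"
  shows "bounded_clinear (adj T)"
proof (rule bounded_clinearI)
  obtain K where K: "\<And>x. norm (T x) \<le> norm x * K"
    using T by (auto simp: bounded_clinear_def)
  show "bounded_linear (adj T)"
  proof (rule bounded_linear_intro[where K = "\<bar>K\<bar>"])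
    show "adj T (x + y) = adj T x + adj T y" for x y
      by (rule rinner_eqI) (simp add: adj_rinner(1)[OF T, symmetric] rinner_simps)
    show "adj T (r *\<^sub>R x) = r *\<^sub>R adj T x" for r x
      by (rule rinner_eqI) (simp add: adj_rinner(1)[OF T, symmetric] rinner_simps)
    fix x
    have "(norm (adj T x))\<^sup>2 = rinner (T (adj T x)) x"
      by (simp add: adj_rinner(1)[OF T] rinner_self)
    also have "\<dots> \<le> norm (T (adj T x)) * norm x"
      using rinner_Cauchy_Schwarz[of "T (adj T x)" x] by simp
    also have "\<dots> \<le> (norm (adj T x) * \<bar>K\<bar>) * norm x"
    proof (rule mult_right_mono)
      have "norm (adj T x) * K \<le> norm (adj T x) * \<bar>K\<bar>" by (rule mult_left_mono) auto
      with K[of "adj T x"] show "norm (T (adj T x)) \<le> norm (adj T x) * \<bar>K\<bar>" by simp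
    qed simp
    finally show "norm (adj T x) \<le> norm x * \<bar>K\<bar>"
      by (cases "norm (adj T x) = 0") (auto simp: power2_eq_square mult_ac)
  qed
  show "adj T (a *\<^sub>C x) = a *\<^sub>C adj T x" for a x
  proof (rule rinner_eqI)
    fix y
    have "cinner y (adj T (a *\<^sub>C x)) = cinner y (a *\<^sub>C adj T x)"
      by (simp add: adj_cinner[OF T, symmetric] cinner_commute[of _ "a *\<^sub>C _"] cinner_scaleC_left)
        (metis adj_cinner[OF T] cinner_commute)
    then show "rinner y (adj T (a *\<^sub>C x)) = rinner y (a *\<^sub>C adj T x)" by (simp add: rinner_def)
  qed
qed

lemma bounded_linear_funpow: "bounded_linear T \<Longrightarrow> bounded_linear (T ^^ k)"
  for T :: "'a::real_normed_vector \<Rightarrow> 'a"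
  by (induction k) (auto simp: id_def comp_def intro: bounded_linear_compose bounded_linear_ident)

lemma bounded_clinear_comp: "bounded_clinear A \<Longrightarrow> bounded_clinear B \<Longrightarrow> bounded_clinear (A \<circ> B)"
  by (rule bounded_clinearI)
    (simp_all add: comp_def bounded_linear_compose bounded_clinear_imp_bounded_linear bounded_clinear_scaleC)

lemma bounded_clinear_funpow: "bounded_clinear T \<Longrightarrow> bounded_clinear (T ^^ k)"
  for T :: "'a::complex_inner \<Rightarrow> 'a"
proof (induction k)
  case 0
  show ?case by (rule bounded_clinearI) (auto simp: id_def)
qed (simp add: bounded_clinear_comp)

lemma adj_funpow_rinner:
  fixes T :: "'a::chilbert_space \<Rightarrow> 'a"
  assumes "bounded_clinear T"
  shows "rinner ((T ^^ k) x) y = rinner x ((adj T ^^ k) y)"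
proof (induction k arbitrary: y)
  case (Suc k)
  have "rinner (T ((T ^^ k) x)) y = rinner x ((adj T ^^ k) (adj T y))"
    by (simp only: adj_rinner(1)[OF assms] Suc)
  then show ?case by (simp add: funpow_swap1[of "adj T"])
qed simp

lemma adj_funpow:
  fixes T :: "'a::chilbert_space \<Rightarrow> 'a"
  assumes "bounded_clinear T"
  shows "adj (T ^^ k) = adj T ^^ k"
  by (rule adj_unique[OF bounded_clinear_funpow[OF assms] adj_funpow_rinner[OF assms]])

section \<open>Self-adjoint operators\<close>

text \<open>Only real linearity is asked for; complex linearity is carried separately by
  \<open>bounded_clinear\<close>.\<close>

definition self_adjoint :: "('a::complex_inner \<Rightarrow> 'a) \<Rightarrow> bool" where
  "self_adjoint A \<longleftrightarrow> bounded_linear A \<and> (\<forall>x y. rinner (A x) y = rinner x (A y))"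

lemma self_adjoint_bl: "self_adjoint A \<Longrightarrow> bounded_linear A"
  by (simp add: self_adjoint_def)

lemma self_adjoint_rinner: "self_adjoint A \<Longrightarrow> rinner (A x) y = rinner x (A y)"
  by (simp add: self_adjoint_def)

lemma self_adjoint_funpow_rinner:
  assumes A: "self_adjoint A"
  shows "rinner ((A ^^ k) x) y = rinner x ((A ^^ k) y)"
proof (induction k arbitrary: y)
  case (Suc k)
  have "rinner (A ((A ^^ k) x)) y = rinner x ((A ^^ k) (A y))"
    by (simp only: self_adjoint_rinner[OF A] Suc)
  then show ?case by (simp add: funpow_swap1)
qed simp

lemma self_adjoint_funpow: "self_adjoint A \<Longrightarrow> self_adjoint (A ^^ k)"
  using self_adjoint_funpow_rinner[of A] bounded_linear_funpow[of A] unfolding self_adjoint_def by blast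

lemma self_adjoint_diff: "self_adjoint A \<Longrightarrow> self_adjoint B \<Longrightarrow> self_adjoint (\<lambda>x. A x - B x)"
  by (auto simp: self_adjoint_def rinner_simps intro: bounded_linear_sub)

lemma funpow_norm_square:
  assumes "self_adjoint A"
  shows "(norm ((A ^^ k) x))\<^sup>2 = rinner x ((A ^^ (2 * k)) x)"
  unfolding rinner_self[symmetric]
  by (simp add: self_adjoint_funpow_rinner[OF assms] mult_2 funpow_add)

text \<open>Polarisation: by symmetry the form at \<open>x + y\<close> has cross terms
  \<open>2 * rinner y (A x)\<close>. This is how equalities of quadratic forms become equalities of
  operators.\<close>

lemma self_adjoint_eq_zeroI:
  assumes A: "self_adjoint A" and zero: "\<And>x. rinner (A x) x = 0"
  shows "A x = 0"
proof -
  have "rinner (A (x + y)) (x + y) = 2 * rinner y (A x) + rinner (A x) x + rinner (A y) y" for y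
    using A by (simp add: self_adjoint_bl linear_simps rinner_simps self_adjoint_rinner
        rinner_commute[of x "A y"])
  then have "rinner y (A x) = rinner y 0" for y by (simp add: zero)
  then show ?thesis by (rule rinner_eqI)
qed

text \<open>The form has zero imaginary part; polarising this at \<open>x + \<i> *\<^sub>C y\<close>
  leaves two cross terms whose cancellation is the symmetry of \<open>A\<close>.\<close>

lemma positive_op_self_adjoint:
  assumes A: "bounded_clinear A" and pos: "positive_op A"
  shows "self_adjoint A"
proof -
  have bl: "bounded_linear A" by (rule bounded_clinear_imp_bounded_linear[OF A])
  have im: "rinner (\<i> *\<^sub>C x) (A x) = 0" for x
    using pos by (simp add: positive_op_def cinner_eq_rinner)
  have i2: "\<i> *\<^sub>C (\<i> *\<^sub>C x) = - x" for x :: 'a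
    using scaleR_scaleC[of "-1" x] by (simp add: scaleC_scaleC)
  have "rinner (A x) y = rinner x (A y)" for x y
  proof -
    have "rinner (\<i> *\<^sub>C (x + \<i> *\<^sub>C y)) (A (x + \<i> *\<^sub>C y)) = 0" by (rule im)
    then have "rinner (\<i> *\<^sub>C x) (\<i> *\<^sub>C A y) = rinner y (A x)"
      using im[of x] im[of "\<i> *\<^sub>C y"] rinner_scaleR_left[of "-1" y]
      by (simp add: scaleC_add_right rinner_simps bl linear_simps i2 bounded_clinear_scaleC[OF A])
    moreover have "rinner (\<i> *\<^sub>C x) (\<i> *\<^sub>C A y) = rinner x (A y)"
      unfolding rinner_def
      by (simp add: cinner_scaleC_left cinner_commute[of x "\<i> *\<^sub>C A y"])
        (simp add: cinner_commute[of x "A y"])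
    ultimately show ?thesis by (simp add: rinner_commute)
  qed
  with bl show ?thesis by (simp add: self_adjoint_def)
qed

lemma positive_op_rinner: "positive_op A \<Longrightarrow> 0 \<le> rinner x (A x)"
  by (simp add: positive_op_def rinner_def)

lemma positive_opI:
  assumes A: "bounded_clinear A" "self_adjoint A" and pos: "\<And>x. 0 \<le> rinner x (A x)"
  shows "positive_op A"
proof -
  have "cinner (A x) x = cinner x (A x)" for x
    by (simp add: cinner_eq_rinner self_adjoint_rinner[OF A(2), symmetric] bounded_clinear_scaleC[OF A(1)])
  then have "Im (cinner x (A x)) = 0" for x
    using cinner_commute[of x "A x"] by (metis Reals_cnj_iff complex_is_Real_iff)
  with pos show ?thesis by (simp add: positive_op_def rinner_def)
qed

instance chilbert_space \<subseteq> banach ..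

section \<open>Power series in a contraction\<close>

text \<open>The functional calculus \<open>f(K)\<close> for a contraction \<open>K\<close> and
  absolutely summable coefficients. Indexing it by formal power series lets algebraic identities
  between series pass to operators.\<close>

definition fps_op :: "('a::chilbert_space \<Rightarrow> 'a) \<Rightarrow> real fps \<Rightarrow> 'a \<Rightarrow> 'a" where
  "fps_op K f x = (\<Sum>\<^sub>\<infinity>k. fps_nth f k *\<^sub>R (K ^^ k) x)"

definition fps_abs_summable :: "real fps \<Rightarrow> bool" where
  "fps_abs_summable f \<longleftrightarrow> (\<lambda>k. norm (fps_nth f k)) summable_on UNIV"

lemma bounded_linear_infsum:
  fixes h :: "'b::banach \<Rightarrow> 'c::banach"
  assumes "bounded_linear h" "f summable_on A"
  shows "h (infsum f A) = (\<Sum>\<^sub>\<infinity>x\<in>A. h (f x))"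
  using has_sum_bounded_linear[OF assms(1) has_sum_infsum[OF assms(2)]] by (simp add: infsumI)

lemma fps_abs_summable_pairs:
  assumes "fps_abs_summable f" "fps_abs_summable g"
  shows "(\<lambda>p. norm ((\<lambda>(i, j). fps_nth f i * fps_nth g j) p)) summable_on UNIV \<times> UNIV"
proof -
  have g: "(\<lambda>j. \<bar>fps_nth g j\<bar>) summable_on UNIV" and f: "(\<lambda>j. \<bar>fps_nth f j\<bar>) summable_on UNIV"
    using assms by (auto simp: fps_abs_summable_def)
  show ?thesis
    unfolding Infinite_Sum.abs_summable_on_Sigma_iff
    using g f
    by (auto simp: abs_mult infsum_cmult_right' abs_of_nonneg infsum_nonneg
        intro!: summable_on_cmult_right summable_on_cmult_left)
qed

text \<open>The Cauchy product regroups the summable family of all pairs along antidiagonals;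
  \<open>bij\<close> is that regrouping.\<close>

lemma fps_abs_summable_mult:
  assumes f: "fps_abs_summable f" and g: "fps_abs_summable g"
  shows "fps_abs_summable (f * g)"
proof -
  have bij: "bij_betw (\<lambda>(n, i). (i, n - i)) (SIGMA n:UNIV. {..n}) (UNIV \<times> (UNIV :: nat set))"
    by (rule bij_betwI[where g = "\<lambda>(i, j). (i + j, i)"]) auto
  have s: "(\<lambda>p. norm ((\<lambda>(n, i). fps_nth f i * fps_nth g (n - i)) p)) summable_on (SIGMA n:UNIV. {..n})"
    using summable_on_reindex_bij_betw[OF bij, of "\<lambda>p. norm ((\<lambda>(i, j). fps_nth f i * fps_nth g j) p)"]
      fps_abs_summable_pairs[OF f g] by (simp add: case_prod_unfold)
  have s2: "(\<lambda>n. \<Sum>\<^sub>\<infinity>i\<in>{..n}. norm (fps_nth f i * fps_nth g (n - i))) summable_on UNIV"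
    using iffD1[OF Infinite_Sum.abs_summable_on_Sigma_iff s, THEN conjunct2] by (simp add: sum_nonneg)
  have eq: "fps_nth (f * g) n = (\<Sum>i\<le>n. fps_nth f i * fps_nth g (n - i))" for n
    by (simp add: fps_mult_nth atMost_atLeast0)
  show ?thesis
    unfolding fps_abs_summable_def
    by (rule Infinite_Sum.abs_summable_on_comparison_test'[OF s2]) (auto simp: eq intro: sum_abs order_trans[OF sum_abs])
qed

context
  fixes K :: "'a::chilbert_space \<Rightarrow> 'a"
  assumes K: "bounded_linear K" and contr: "\<And>x. norm (K x) \<le> norm x"
begin

lemma norm_funpow_contraction: "norm ((K ^^ k) x) \<le> norm x"
  by (induction k) (auto intro: order_trans[OF contr])

lemma fps_op_abs_summable:
  assumes "fps_abs_summable f"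
  shows "(\<lambda>p. norm ((\<lambda>k. fps_nth f k *\<^sub>R (K ^^ k) x) p)) summable_on UNIV"
proof (rule Infinite_Sum.abs_summable_on_comparison_test')
  show "(\<lambda>k. \<bar>fps_nth f k\<bar> * norm x) summable_on UNIV"
    using assms by (intro summable_on_cmult_left) (simp add: fps_abs_summable_def)
qed (simp add: mult_left_mono norm_funpow_contraction)

lemma fps_op_summable:
  "fps_abs_summable f \<Longrightarrow> (\<lambda>k. fps_nth f k *\<^sub>R (K ^^ k) x) summable_on UNIV"
  by (rule Infinite_Sum.abs_summable_summable[OF fps_op_abs_summable])

text \<open>Commutation passes to the powers of \<open>K\<close> and, by continuity, to the sum.
  With scalar multiplication as \<open>L\<close> it gives homogeneity; with general
  \<open>L\<close>, the bicommutant property.\<close>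

lemma fps_op_commute:
  assumes f: "fps_abs_summable f" and L: "bounded_linear L" "\<And>x. L (K x) = K (L x)"
  shows "L (fps_op K f x) = fps_op K f (L x)"
proof -
  have "L ((K ^^ k) x) = (K ^^ k) (L x)" for k by (induction k) (simp_all add: L)
  then show ?thesis
    unfolding fps_op_def using L(1)
    by (simp add: bounded_linear_infsum[OF L(1) fps_op_summable[OF f]] linear_simps)
qed

lemma bounded_linear_fps_op:
  assumes f: "fps_abs_summable f"
  shows "bounded_linear (fps_op K f)"
proof (rule bounded_linear_intro)
  interpret Kk: bounded_linear "K ^^ k" for k by (rule bounded_linear_funpow[OF K])
  show "fps_op K f (x + y) = fps_op K f x + fps_op K f y" for x y
    unfolding fps_op_def
    by (simp add: Kk.add scaleR_add_right infsum_add fps_op_summable[OF f])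
  show "fps_op K f (r *\<^sub>R x) = r *\<^sub>R fps_op K f x" for r x
    by (rule fps_op_commute[OF f bounded_linear_scaleR_right, symmetric])
      (use K in \<open>simp add: linear_simps\<close>)
  fix x
  have "norm (fps_op K f x) \<le> (\<Sum>\<^sub>\<infinity>k. norm (fps_nth f k *\<^sub>R (K ^^ k) x))"
    unfolding fps_op_def by (rule norm_infsum_bound[OF fps_op_abs_summable[OF f]])
  also have "\<dots> \<le> (\<Sum>\<^sub>\<infinity>k. \<bar>fps_nth f k\<bar> * norm x)"
    by (rule infsum_mono[OF fps_op_abs_summable[OF f]])
      (use f in \<open>auto simp: fps_abs_summable_def norm_funpow_contraction mult_left_mono intro!: summable_on_cmult_left\<close>)
  also have "\<dots> = norm x * (\<Sum>\<^sub>\<infinity>k. \<bar>fps_nth f k\<bar>)"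
    by (simp add: infsum_cmult_right' mult.commute)
  finally show "norm (fps_op K f x) \<le> norm x * (\<Sum>\<^sub>\<infinity>k. \<bar>fps_nth f k\<bar>)" .
qed

text \<open>Absolute summability of the double family \<open>t\<close> permits summing it by rows or
  by antidiagonals.\<close>

lemma fps_op_mult:
  assumes f: "fps_abs_summable f" and g: "fps_abs_summable g"
  shows "fps_op K (f * g) x = fps_op K f (fps_op K g x)"
proof -
  interpret Kk: bounded_linear "K ^^ k" for k by (rule bounded_linear_funpow[OF K])
  define t where "t = (\<lambda>(i, j). (fps_nth f i * fps_nth g j) *\<^sub>R (K ^^ (i + j)) x)"
  have bij: "bij_betw (\<lambda>(n, i). (i, n - i)) (SIGMA n:UNIV. {..n}) (UNIV \<times> (UNIV :: nat set))"
    by (rule bij_betwI[where g = "\<lambda>(i, j). (i + j, i)"]) auto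
  have "(\<lambda>p. norm (t p)) summable_on UNIV \<times> UNIV"
  proof (rule Infinite_Sum.abs_summable_on_comparison_test')
    show "(\<lambda>p. norm ((\<lambda>(i, j). fps_nth f i * fps_nth g j) p) * norm x) summable_on UNIV \<times> UNIV"
      by (intro summable_on_cmult_left fps_abs_summable_pairs f g)
  qed (auto simp: t_def mult_left_mono norm_funpow_contraction)
  then have t: "t summable_on UNIV \<times> UNIV" by (rule Infinite_Sum.abs_summable_summable)
  have t2: "(\<lambda>p. t ((\<lambda>(n, i). (i, n - i)) p)) summable_on (SIGMA n:UNIV. {..n})"
    using t by (subst summable_on_reindex_bij_betw[OF bij])
  have "fps_op K f (fps_op K g x) =
      (\<Sum>\<^sub>\<infinity>i. fps_nth f i *\<^sub>R (\<Sum>\<^sub>\<infinity>j. (K ^^ i) (fps_nth g j *\<^sub>R (K ^^ j) x)))"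
    unfolding fps_op_def by (simp add: bounded_linear_infsum[OF Kk.bounded_linear_axioms fps_op_summable[OF g]])
  also have "\<dots> = (\<Sum>\<^sub>\<infinity>i. \<Sum>\<^sub>\<infinity>j. t (i, j))"
    by (simp add: t_def infsum_scaleR_right[symmetric] Kk.scaleR funpow_add)
  also have "\<dots> = infsum t (UNIV \<times> UNIV)"
    by (rule infsum_Sigma_banach[OF t])
  also have "\<dots> = infsum (\<lambda>p. t ((\<lambda>(n, i). (i, n - i)) p)) (SIGMA n:UNIV. {..n})"
    by (rule infsum_reindex_bij_betw[OF bij, symmetric])
  also have "\<dots> = (\<Sum>\<^sub>\<infinity>n. \<Sum>\<^sub>\<infinity>i\<in>{..n}. t (i, n - i))"
    using infsum_Sigma_banach[OF t2] by simp
  also have "\<dots> = (\<Sum>\<^sub>\<infinity>n. fps_nth (f * g) n *\<^sub>R (K ^^ n) x)"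
    by (intro infsum_cong) (simp add: t_def fps_mult_nth atMost_atLeast0 scaleR_sum_left)
  finally show ?thesis by (simp add: fps_op_def)
qed

lemma fps_op_finite:
  assumes "\<And>k. k > N \<Longrightarrow> fps_nth f k = 0"
  shows "fps_abs_summable f" "fps_op K f x = (\<Sum>k\<le>N. fps_nth f k *\<^sub>R (K ^^ k) x)"
proof -
  have "(\<lambda>k. norm (fps_nth f k)) summable_on UNIV \<longleftrightarrow> (\<lambda>k. norm (fps_nth f k)) summable_on {..N}"
    by (rule summable_on_cong_neutral) (use assms in \<open>auto simp: not_le\<close>)
  then show "fps_abs_summable f" by (simp add: fps_abs_summable_def)
  have "fps_op K f x = (\<Sum>\<^sub>\<infinity>k\<in>{..N}. fps_nth f k *\<^sub>R (K ^^ k) x)"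
    unfolding fps_op_def by (rule infsum_cong_neutral) (use assms in \<open>auto simp: not_le\<close>)
  then show "fps_op K f x = (\<Sum>k\<le>N. fps_nth f k *\<^sub>R (K ^^ k) x)" by simp
qed

lemma fps_op_power:
  assumes f: "fps_abs_summable f"
  shows "fps_abs_summable (f ^ m) \<and> fps_op K (f ^ m) = fps_op K f ^^ m"
proof (induction m)
  case 0
  show ?case using fps_op_finite[of 0 "f ^ 0"] by (auto simp: fun_eq_iff)
next
  case (Suc m)
  then show ?case
    using fps_abs_summable_mult[OF f] fps_op_mult[OF f] by (auto simp: fun_eq_iff)
qed

lemma rinner_fps_op:
  assumes "fps_abs_summable f"
  shows "rinner y (fps_op K f x) = (\<Sum>\<^sub>\<infinity>k. fps_nth f k * rinner y ((K ^^ k) x))"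
  unfolding fps_op_def
  by (simp add: bounded_linear_infsum[OF bounded_linear_rinner_right fps_op_summable[OF assms]] rinner_simps)

end

section \<open>Roots of positive operators\<close>

text \<open>The power series of \<open>(1 - t)\<^sup>\<alpha>\<close>.\<close>
definition root_fps :: "real \<Rightarrow> real fps" where
  "root_fps \<alpha> = fps_compose (fps_binomial \<alpha>) (- fps_X)"

lemma root_fps_nth: "fps_nth (root_fps \<alpha>) k = (\<alpha> gchoose k) * (-1) ^ k"
  using fps_compose_linear[of "fps_binomial \<alpha>" "-1"]
  by (simp add: root_fps_def fps_const_neg[symmetric] del: fps_const_neg)

lemma root_fps_power:
  assumes "m > 0"
  shows "root_fps (1 / real m) ^ m = 1 - fps_X"
proof -
  have "root_fps (1 / real m) ^ m = fps_compose (fps_binomial (1 / real m) ^ m) (- fps_X)"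
    unfolding root_fps_def by (simp add: fps_compose_power)
  also have "fps_binomial (1 / real m) ^ m = 1 + fps_X"
    using assms by (simp add: fps_binomial_power fps_binomial_1)
  finally show ?thesis by (simp add: fps_compose_add_distrib)
qed

text \<open>The two alternating signs cancel, leaving
  \<open>pochhammer (- \<alpha>) k / fact k\<close>, whose first factor is \<open>- \<alpha>\<close>
  and whose others are nonnegative.\<close>

lemma root_fps_nonpos:
  assumes "0 < \<alpha>" "\<alpha> \<le> 1" "k > 0"
  shows "fps_nth (root_fps \<alpha>) k \<le> 0"
proof -
  obtain j where j: "k = Suc j" using assms by (cases k) auto
  have "(-1) ^ k * ((-1) ^ k :: real) = 1" by (simp add: power_mult_distrib[symmetric])
  then have "fps_nth (root_fps \<alpha>) k = pochhammer (- \<alpha>) k / fact k"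
    by (simp add: root_fps_nth gbinomial_pochhammer mult.assoc)
  also have "pochhammer (- \<alpha>) k = - \<alpha> * pochhammer (1 - \<alpha>) j" by (simp add: j pochhammer_rec)
  also have "pochhammer (1 - \<alpha>) j \<ge> 0"
    using assms by (auto simp: pochhammer_prod intro!: prod_nonneg)
  then have "- \<alpha> * pochhammer (1 - \<alpha>) j / fact k \<le> 0" using assms
    by (simp add: divide_nonpos_pos mult_nonneg_nonneg)
  finally show ?thesis .
qed

text \<open>The partial sums are the coefficients of \<open>(1 - t)\<close> to the power
  \<open>\<alpha> - 1\<close>, which are nonnegative.\<close>

lemma root_fps_sum_nonneg:
  assumes "\<alpha> \<le> 1"
  shows "0 \<le> (\<Sum>k\<le>N. fps_nth (root_fps \<alpha>) k)"
proof -
  have "(-1) ^ N * ((-1) ^ N :: real) = 1" by (simp add: power_mult_distrib[symmetric])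
  moreover have "(\<Sum>k\<le>N. fps_nth (root_fps \<alpha>) k) = (-1) ^ N * (\<alpha> - 1 gchoose N)"
    by (simp only: root_fps_nth gbinomial_sum_lower_neg)
  ultimately have "(\<Sum>k\<le>N. fps_nth (root_fps \<alpha>) k) = pochhammer (1 - \<alpha>) N / fact N"
    by (simp add: gbinomial_pochhammer)
  also have "\<dots> \<ge> 0" using assms by (auto simp: pochhammer_prod intro!: prod_nonneg divide_nonneg_pos)
  finally show ?thesis .
qed

text \<open>Only the constant coefficient 1 is positive, so a partial sum of absolute values is 2
  minus the corresponding signed sum.\<close>

lemma root_fps_summable:
  assumes "0 < \<alpha>" "\<alpha> \<le> 1"
  shows "fps_abs_summable (root_fps \<alpha>)" "(\<Sum>\<^sub>\<infinity>k. \<bar>fps_nth (root_fps \<alpha>) k\<bar>) \<le> 2"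
proof -
  let ?a = "\<lambda>k. fps_nth (root_fps \<alpha>) k"
  have a0: "?a 0 = 1" by (simp add: root_fps_nth)
  have bound: "(\<Sum>k\<le>N. \<bar>?a k\<bar>) \<le> 2" for N
  proof -
    have "(\<Sum>k\<le>N. \<bar>?a k\<bar>) = (\<Sum>k\<le>N. (if k = 0 then 2 else 0) - ?a k)"
      by (rule sum.cong) (use a0 root_fps_nonpos[OF assms] in \<open>auto simp: abs_of_nonpos\<close>)
    also have "\<dots> = 2 - (\<Sum>k\<le>N. ?a k)" by (simp add: sum_subtractf)
    finally show ?thesis using root_fps_sum_nonneg[OF assms(2), of N] by simp
  qed
  have fin: "(\<Sum>k\<in>F. \<bar>?a k\<bar>) \<le> 2" if "finite F" for F
  proof -
    obtain N where "F \<subseteq> {..N}" using \<open>finite F\<close> finite_nat_iff_bounded_le by blast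
    then have "(\<Sum>k\<in>F. \<bar>?a k\<bar>) \<le> (\<Sum>k\<le>N. \<bar>?a k\<bar>)" by (intro sum_mono2) auto
    with bound[of N] show ?thesis by simp
  qed
  show s: "fps_abs_summable (root_fps \<alpha>)"
    unfolding fps_abs_summable_def
    by (rule nonneg_bdd_above_summable_on) (use fin in \<open>auto intro!: bdd_aboveI\<close>)
  show "(\<Sum>\<^sub>\<infinity>k. \<bar>?a k\<bar>) \<le> 2"
    by (rule infsum_le_finite_sums) (use s fin in \<open>auto simp: fps_abs_summable_def\<close>)
qed

text \<open>Recorded for the constructed roots because uniqueness of the positive square root relies
  on any other root commuting with the constructed one.\<close>

definition in_bicommutant :: "('a::real_normed_vector \<Rightarrow> 'a) \<Rightarrow> ('a \<Rightarrow> 'a) \<Rightarrow> bool" where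
  "in_bicommutant A D \<longleftrightarrow>
     (\<forall>L. bounded_linear L \<longrightarrow> (\<forall>x. L (A x) = A (L x)) \<longrightarrow> (\<forall>x. L (D x) = D (L x)))"

text \<open>The root is the binomial series of \<open>(1 - t)\<close> to the power
  \<open>1 / m\<close>, evaluated at \<open>K\<close>; the formal identity
  \<open>root_fps_power\<close> gives its \<open>m\<close>-th power.\<close>

lemma contraction_root_exists:
  fixes K :: "'a::chilbert_space \<Rightarrow> 'a"
  assumes Kc: "bounded_clinear K" and K: "self_adjoint K" and contr: "\<And>x. norm (K x) \<le> norm x"
    and m: "m > 0"
  obtains D where "bounded_clinear D" "self_adjoint D" "\<And>x. 0 \<le> rinner x (D x)"
    "\<And>x. (D ^^ m) x = x - K x" "in_bicommutant K D"
proof -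
  define f where "f = root_fps (1 / real m)"
  have \<alpha>: "0 < 1 / real m" "1 / real m \<le> 1" using m by auto
  have f: "fps_abs_summable f" and f2: "(\<Sum>\<^sub>\<infinity>k. \<bar>fps_nth f k\<bar>) \<le> 2"
    using root_fps_summable[OF \<alpha>] by (auto simp: f_def)
  have Kb: "bounded_linear K" by (rule self_adjoint_bl[OF K])
  note ops = Kb contr
  let ?D = "fps_op K f"
  have Db: "bounded_linear ?D" by (rule bounded_linear_fps_op[OF ops f])
  have comm: "L (?D x) = ?D (L x)" if "bounded_linear L" "\<And>x. L (K x) = K (L x)" for L x
    by (rule fps_op_commute[OF ops f that])
  have Dc: "bounded_clinear ?D"
    by (rule bounded_clinearI[OF Db])
      (rule comm[OF bounded_linear_scaleC bounded_clinear_scaleC[OF Kc, symmetric], symmetric])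
  have Ds: "self_adjoint ?D"
  proof -
    have "rinner (?D x) y = rinner x (?D y)" for x y
    proof -
      have "rinner y ((K ^^ k) x) = rinner x ((K ^^ k) y)" for k
        using self_adjoint_funpow_rinner[OF K, of k x y] by (simp only: rinner_commute)
      then show ?thesis
        unfolding rinner_commute[of "?D x"] by (simp add: rinner_fps_op[OF ops f])
    qed
    with Db show ?thesis by (simp add: self_adjoint_def)
  qed
  have pos: "0 \<le> rinner x (?D x)" for x
  proof -
    let ?a = "\<lambda>k. fps_nth f k"
    have sa: "(\<lambda>k. \<bar>?a k\<bar> * (norm x)\<^sup>2) summable_on UNIV"
      using f by (intro summable_on_cmult_left) (simp add: fps_abs_summable_def)
    have sr: "(\<lambda>k. ?a k * rinner x ((K ^^ k) x)) summable_on UNIV"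
      using summable_on_bounded_linear[OF bounded_linear_rinner_right fps_op_summable[OF ops f], of x x]
      by (simp add: rinner_simps)
    have s0: "((\<lambda>k. if k = (0::nat) then 2 * (norm x)\<^sup>2 else 0) has_sum (2 * (norm x)\<^sup>2)) UNIV"
      by (rule has_sum_finite_neutralI[where B = "{0}"]) auto
    \<comment> \<open>Summed over \<open>k\<close>, this bounds the form of \<open>?D\<close> below
      by \<open>(2 - s) * (norm x)\<^sup>2\<close>, where \<open>s \<le> 2\<close> is the sum of the
      \<open>\<bar>?a k\<bar>\<close>. The 2 at \<open>k = 0\<close> compensates for subtracting the
      constant coefficient 1.\<close>
    have le: "(if k = 0 then 2 * (norm x)\<^sup>2 else 0) - \<bar>?a k\<bar> * (norm x)\<^sup>2 \<le> ?a k * rinner x ((K ^^ k) x)" for k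
    proof (cases "k = 0")
      case True
      then show ?thesis by (simp add: f_def root_fps_nth rinner_self)
    next
      case False
      have "\<bar>rinner x ((K ^^ k) x)\<bar> \<le> norm x * norm ((K ^^ k) x)" by (rule rinner_Cauchy_Schwarz)
      also have "\<dots> \<le> (norm x)\<^sup>2"
        by (simp add: power2_eq_square mult_left_mono norm_funpow_contraction[OF ops])
      finally have "\<bar>?a k * rinner x ((K ^^ k) x)\<bar> \<le> \<bar>?a k\<bar> * (norm x)\<^sup>2"
        by (simp add: abs_mult mult_left_mono)
      with False show ?thesis by simp
    qed
    have "2 * (norm x)\<^sup>2 = (\<Sum>\<^sub>\<infinity>k. if k = (0::nat) then 2 * (norm x)\<^sup>2 else 0)"
      by (rule infsumI[OF s0, symmetric])
    also have "\<dots> \<le> (\<Sum>\<^sub>\<infinity>k. \<bar>?a k\<bar> * (norm x)\<^sup>2 + ?a k * rinner x ((K ^^ k) x))"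
      by (rule infsum_mono[OF has_sum_imp_summable[OF s0] summable_on_add[OF sa sr]])
        (use le in \<open>simp add: algebra_simps\<close>)
    also have "\<dots> = (\<Sum>\<^sub>\<infinity>k. \<bar>?a k\<bar>) * (norm x)\<^sup>2 + rinner x (?D x)"
      by (simp add: infsum_add[OF sa sr] infsum_cmult_left' rinner_fps_op[OF ops f])
    also have "\<dots> \<le> 2 * (norm x)\<^sup>2 + rinner x (?D x)"
      using f2 by (intro add_right_mono mult_right_mono) auto
    finally show ?thesis by simp
  qed
  have "(?D ^^ m) x = x - K x" for x
  proof -
    have "(?D ^^ m) x = fps_op K (1 - fps_X) x"
      using fps_op_power[OF ops f, of m] root_fps_power[OF m] by (simp add: f_def)
    also have "\<dots> = (\<Sum>k\<le>1. fps_nth (1 - fps_X) k *\<^sub>R (K ^^ k) x)"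
      by (rule fps_op_finite(2)[OF ops]) auto
    finally show ?thesis by simp
  qed
  moreover have "in_bicommutant K ?D" using comm by (simp add: in_bicommutant_def)
  ultimately show ?thesis using that[OF Dc Ds pos] by blast
qed

lemma self_adjoint_adj_comp:
  fixes A :: "'a::chilbert_space \<Rightarrow> 'a"
  assumes "bounded_clinear A"
  shows "self_adjoint (adj A \<circ> A)"
  using bounded_clinear_imp_bounded_linear[OF bounded_clinear_comp[OF bounded_clinear_adj[OF assms] assms]]
  by (simp add: self_adjoint_def adj_rinner(1)[OF assms, symmetric])
    (simp add: adj_rinner(2)[OF assms, symmetric])

text \<open>Scaling \<open>M = adj A \<circ> A\<close> by \<open>1 / c\<^sup>2\<close> puts it
  between 0 and 1, so that \<open>contraction_root_exists\<close> applies to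
  \<open>K = 1 - M / c\<^sup>2\<close>; the root is then scaled back.\<close>

lemma positive_root_exists:
  fixes A :: "'a::chilbert_space \<Rightarrow> 'a"
  assumes A: "bounded_clinear A" and m: "m > 0"
  obtains D where "bounded_clinear D" "self_adjoint D" "\<And>x. 0 \<le> rinner x (D x)"
    "D ^^ m = adj A \<circ> A" "in_bicommutant (adj A \<circ> A) D"
proof -
  define M where "M = adj A \<circ> A"
  have M: "self_adjoint M" unfolding M_def by (rule self_adjoint_adj_comp[OF A])
  have Mc: "bounded_clinear M"
    unfolding M_def by (rule bounded_clinear_comp[OF bounded_clinear_adj[OF A] A])
  interpret A: bounded_linear A by (rule bounded_clinear_imp_bounded_linear[OF A])
  interpret M: bounded_linear M by (rule self_adjoint_bl[OF M])
  obtain c where c: "c > 0" "\<And>x. norm (A x) \<le> norm x * c" using A.pos_bounded by blast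
  define K where "K x = x - (1 / c\<^sup>2) *\<^sub>R M x" for x
  have Mx: "rinner x (M x) = (norm (A x))\<^sup>2" for x
    by (simp add: M_def adj_rinner(1)[OF A, symmetric] rinner_self)
  have Kb: "bounded_linear K"
    unfolding K_def
    by (intro bounded_linear_sub bounded_linear_ident bounded_linear_const_scaleR M.bounded_linear_axioms)
  have K: "self_adjoint K"
    unfolding self_adjoint_def using Kb by (simp add: K_def rinner_simps self_adjoint_rinner[OF M])
  have Kc: "bounded_clinear K"
  proof (rule bounded_clinearI[OF Kb])
    interpret C: bounded_linear "\<lambda>x::'a. a *\<^sub>C x" for a by (rule bounded_linear_scaleC)
    show "K (a *\<^sub>C x) = a *\<^sub>C K x" for a x
      by (simp add: K_def bounded_clinear_scaleC[OF Mc] C.diff C.scaleR)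
  qed
  \<comment> \<open>Because \<open>norm (M x) \<le> c * norm (A x)\<close>, the quadratic term of
    \<open>(norm (K x))\<^sup>2\<close> is at most half of the subtracted cross term.\<close>
  have contr: "norm (K x) \<le> norm x" for x
  proof -
    have "(norm (M x))\<^sup>2 = rinner (A (M x)) (A x)"
      by (simp add: rinner_self[symmetric] adj_rinner(1)[OF A]) (simp add: M_def)
    also have "\<dots> \<le> norm (A (M x)) * norm (A x)"
      using rinner_Cauchy_Schwarz[of "A (M x)" "A x"] by simp
    also have "\<dots> \<le> norm (M x) * c * norm (A x)" by (intro mult_right_mono c) simp
    finally have "norm (M x) \<le> c * norm (A x)"
      by (cases "norm (M x) = 0") (use c in \<open>auto simp: power2_eq_square mult_ac\<close>)
    then have "(norm (M x))\<^sup>2 \<le> c\<^sup>2 * (norm (A x))\<^sup>2"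
      by (metis norm_ge_zero power_mono power_mult_distrib)
    then have "(1 / c\<^sup>2) * ((1 / c\<^sup>2) * (norm (M x))\<^sup>2) \<le> (1 / c\<^sup>2) * (norm (A x))\<^sup>2"
      using c by (intro mult_left_mono) (auto simp: field_simps)
    moreover have "(norm (K x))\<^sup>2 =
        (norm x)\<^sup>2 - 2 * ((1 / c\<^sup>2) * (norm (A x))\<^sup>2) + (1 / c\<^sup>2) * ((1 / c\<^sup>2) * (norm (M x))\<^sup>2)"
      unfolding rinner_self[symmetric] Mx[symmetric, unfolded rinner_self[symmetric]] K_def
      by (simp add: rinner_simps rinner_commute[of "M x" x] algebra_simps)
    moreover have "0 \<le> (1 / c\<^sup>2) * (norm (A x))\<^sup>2" by simp
    ultimately have "(norm (K x))\<^sup>2 \<le> (norm x)\<^sup>2" by linarith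
    then show ?thesis by (rule power2_le_imp_le) simp
  qed
  obtain D where D: "bounded_clinear D" "self_adjoint D" "\<And>x. 0 \<le> rinner x (D x)"
      "\<And>x. (D ^^ m) x = x - K x" "in_bicommutant K D"
    using contraction_root_exists[OF Kc K contr m] by blast
  interpret D: bounded_linear D by (rule self_adjoint_bl[OF D(2)])
  define r where "r = root m (c\<^sup>2)"
  have r: "r \<ge> 0" "r ^ m = c\<^sup>2" using m by (simp_all add: r_def)
  define E where "E x = r *\<^sub>R D x" for x
  have Eb: "bounded_linear E"
    unfolding E_def by (rule bounded_linear_const_scaleR[OF D.bounded_linear_axioms])
  have Epow: "(E ^^ j) x = (r ^ j) *\<^sub>R (D ^^ j) x" for j x
    by (induction j) (simp_all add: E_def D.scaleR)
  show ?thesis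
  proof
    show "bounded_clinear E"
    proof (rule bounded_clinearI[OF Eb])
      interpret C: bounded_linear "\<lambda>x::'a. a *\<^sub>C x" for a by (rule bounded_linear_scaleC)
      show "E (a *\<^sub>C x) = a *\<^sub>C E x" for a x
        by (simp add: E_def bounded_clinear_scaleC[OF D(1)] C.scaleR)
    qed
    show "self_adjoint E"
      unfolding self_adjoint_def using Eb by (simp add: E_def rinner_simps self_adjoint_rinner[OF D(2)])
    show "0 \<le> rinner x (E x)" for x using D(3)[of x] r by (simp add: E_def rinner_simps)
    show "E ^^ m = adj A \<circ> A"
      using c by (simp add: fun_eq_iff Epow r D(4) K_def M_def)
    show "in_bicommutant (adj A \<circ> A) E"
      unfolding in_bicommutant_def
    proof (intro allI impI)
      fix L :: "'a \<Rightarrow> 'a" and x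
      assume L: "bounded_linear L" "\<forall>x. L ((adj A \<circ> A) x) = (adj A \<circ> A) (L x)"
      then have "L (K y) = K (L y)" for y by (simp add: K_def M_def linear_simps)
      with D(5) L(1) have "L (D x) = D (L x)" by (simp add: in_bicommutant_def)
      then show "L (E x) = E (L x)" using L(1) by (simp add: E_def linear_simps)
    qed
  qed
qed

section \<open>Uniqueness of the positive square root\<close>

text \<open>Polarisation gives \<open>E ^^ 3 = 0\<close>, and a nilpotent self-adjoint operator
  vanishes.\<close>

lemma self_adjoint_cube_eq_zero:
  assumes E: "self_adjoint E" and zero: "\<And>x. rinner (E (E (E x))) x = 0"
  shows "E x = 0"
proof -
  have "self_adjoint (E ^^ 3)" by (rule self_adjoint_funpow[OF E])
  then have "(E ^^ 3) y = 0" for y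
    by (rule self_adjoint_eq_zeroI) (simp add: numeral_3_eq_3 zero)
  then have E3: "E (E (E y)) = 0" for y by (simp add: numeral_3_eq_3)
  have "(norm (E (E x)))\<^sup>2 = rinner (E (E (E x))) (E x)"
    by (simp add: rinner_self[symmetric] self_adjoint_rinner[OF E])
  then have "E (E x) = 0" by (simp add: E3)
  moreover have "(norm (E x))\<^sup>2 = rinner (E (E x)) x"
    by (simp add: rinner_self[symmetric] self_adjoint_rinner[OF E])
  ultimately show ?thesis by simp
qed

text \<open>With \<open>E = D - S\<close>, commutation gives \<open>(D + S) E = 0\<close>. The
  nonnegative forms of \<open>D\<close> and \<open>S\<close> at \<open>E x\<close> sum to zero,
  hence both vanish, and so does the form of their difference \<open>E\<close>.\<close>

lemma positive_sqrt_unique: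
  assumes D: "self_adjoint D" "\<And>x. 0 \<le> rinner x (D x)"
    and S: "self_adjoint S" "\<And>x. 0 \<le> rinner x (S x)"
    and sq: "\<And>x. D (D x) = S (S x)" and comm: "\<And>x. D (S x) = S (D x)"
  shows "D = S"
proof -
  interpret D: bounded_linear D by (rule self_adjoint_bl[OF D(1)])
  interpret S: bounded_linear S by (rule self_adjoint_bl[OF S(1)])
  define E where "E x = D x - S x" for x
  have E: "self_adjoint E" unfolding E_def by (rule self_adjoint_diff[OF D(1) S(1)])
  have "rinner (E (E (E x))) x = 0" for x
  proof -
    have "rinner (E x) (D (E x)) + rinner (E x) (S (E x)) = rinner (E x) (D (E x) + S (E x))"
      by (simp add: rinner_simps)
    also have "D (E x) + S (E x) = 0" by (simp add: E_def D.diff S.diff sq comm)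
    finally have "rinner (E x) (D (E x)) = 0" "rinner (E x) (S (E x)) = 0"
      using D(2)[of "E x"] S(2)[of "E x"] by auto
    then have "rinner (E x) (E (E x)) = 0" by (simp add: E_def[of "E x"] rinner_simps)
    then show ?thesis by (simp add: self_adjoint_rinner[OF E])
  qed
  then have "E x = 0" for x by (rule self_adjoint_cube_eq_zero[OF E])
  then show ?thesis by (simp add: E_def fun_eq_iff)
qed

text \<open>A competitor \<open>S'\<close> commutes with its own square
  \<open>adj A \<circ> A\<close>, hence with the constructed root \<open>D\<close> by the
  bicommutant property, so the definite description is well defined.\<close>

lemma op_sqrt_properties:
  fixes A :: "'a::chilbert_space \<Rightarrow> 'a"
  assumes A: "bounded_clinear A"
  defines "S \<equiv> op_sqrt (adj A \<circ> A)"
  shows "bounded_clinear S" "positive_op S" "S \<circ> S = adj A \<circ> A"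
proof -
  obtain D where D: "bounded_clinear D" "self_adjoint D" "\<And>x. 0 \<le> rinner x (D x)"
      "D ^^ 2 = adj A \<circ> A" "in_bicommutant (adj A \<circ> A) D"
    using positive_root_exists[OF A zero_less_numeral] by blast
  have D2: "D \<circ> D = adj A \<circ> A" using D(4) by (simp add: numeral_2_eq_2)
  have "S = D"
    unfolding S_def op_sqrt_def
  proof (rule the_equality)
    show "bounded_clinear D \<and> positive_op D \<and> D \<circ> D = adj A \<circ> A"
      using D(1) D2 positive_opI[OF D(1-3)] by simp
    fix S' assume S': "bounded_clinear S' \<and> positive_op S' \<and> S' \<circ> S' = adj A \<circ> A"
    then have sa: "self_adjoint S'" using positive_op_self_adjoint by blast
    have sq: "S' (S' x) = adj A (A x)" "D (D x) = adj A (A x)" for x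
      using S' D2 by (metis comp_apply)+
    have "D (S' x) = S' (D x)" for x
      using D(5) self_adjoint_bl[OF sa] by (simp add: in_bicommutant_def sq(1)[symmetric])
    then show "S' = D"
      by (intro positive_sqrt_unique[symmetric])
        (use D(2,3) sa S' sq in \<open>simp_all add: positive_op_rinner\<close>)
  qed
  then show "bounded_clinear S" "positive_op S" "S \<circ> S = adj A \<circ> A"
    using D(1) D2 positive_opI[OF D(1-3)] by simp_all
qed

section \<open>A Heinz-type inequality\<close>

text \<open>A Lax-Milgram argument: coercivity with constant \<open>e\<close> gives injectivity and
  the bound on \<open>J\<close>, and the contraction principle applied to \<open>F\<close> gives
  surjectivity.\<close>

lemma positive_shift_inverse:
  fixes R :: "'a::chilbert_space \<Rightarrow> 'a"
  assumes R: "self_adjoint R" "\<And>x. 0 \<le> rinner x (R x)" and e: "e > 0"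
  defines "Q \<equiv> \<lambda>x. R x + e *\<^sub>R x"
  obtains J where "self_adjoint J" "\<And>x. Q (J x) = x" "\<And>x. J (Q x) = x"
    "\<And>x. norm (e *\<^sub>R J x) \<le> norm x"
proof -
  interpret R: bounded_linear R by (rule self_adjoint_bl[OF R(1)])
  have Qb: "bounded_linear Q"
    unfolding Q_def by (intro bounded_linear_add R.bounded_linear_axioms bounded_linear_scaleR_right)
  interpret Q: bounded_linear Q by (rule Qb)
  have Qs: "rinner (Q x) y = rinner x (Q y)" for x y
    by (simp add: Q_def rinner_simps self_adjoint_rinner[OF R(1)])
  have low: "e * (norm x)\<^sup>2 \<le> rinner x (Q x)" for x
    using R(2)[of x] by (simp add: Q_def rinner_simps rinner_self)
  have low': "e * norm x \<le> norm (Q x)" for x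
  proof (cases "x = 0")
    case False
    have "(e * norm x) * norm x \<le> norm (Q x) * norm x"
      using low[of x] rinner_Cauchy_Schwarz[of x "Q x"] by (simp add: power2_eq_square mult_ac)
    with False show ?thesis by simp
  qed simp
  have inj: "x = y" if "Q x = Q y" for x y
    using low'[of "x - y"] that e by (simp add: Q.diff mult_le_0_iff)
  obtain c where c: "c > 0" "\<And>x. norm (Q x) \<le> norm x * c" using Q.pos_bounded by blast
  have surj: "\<exists>x. Q x = y" for y
  proof -
    \<comment> \<open>The factor \<open>1 - 2 * t * e + t\<^sup>2 * c\<^sup>2\<close> is least at
      \<open>e / c\<^sup>2\<close>; the extra \<open>e\<^sup>2\<close> puts \<open>q\<close> in
      \<open>[0, 1)\<close> without comparing \<open>e\<close> and \<open>c\<close>.\<close>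
    define t where "t = e / (c\<^sup>2 + e\<^sup>2)"
    have ce: "c\<^sup>2 + e\<^sup>2 > 0" using e by (simp add: add_nonneg_pos)
    have t: "t > 0" using e ce by (simp add: t_def)
    define F where "F x = x - t *\<^sub>R (Q x - y)" for x
    define q where "q = 1 - e\<^sup>2 / (c\<^sup>2 + e\<^sup>2)"
    have q: "0 \<le> q" "q < 1" using ce e by (auto simp: q_def divide_simps)
    have "(norm (x - t *\<^sub>R Q x))\<^sup>2 \<le> q * (norm x)\<^sup>2" for x
    proof -
      have "(norm (x - t *\<^sub>R Q x))\<^sup>2 = (norm x)\<^sup>2 - 2 * t * rinner x (Q x) + t\<^sup>2 * (norm (Q x))\<^sup>2"
        unfolding rinner_self[symmetric]
        by (simp add: rinner_simps rinner_commute[of "Q x" x] power2_eq_square algebra_simps)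
      also have "\<dots> \<le> (norm x)\<^sup>2 - 2 * t * (e * (norm x)\<^sup>2) + t\<^sup>2 * (norm x * c)\<^sup>2"
        using t by (intro add_mono diff_mono mult_left_mono low power_mono c) auto
      also have "\<dots> = (1 - 2 * t * e + t * (t * c\<^sup>2)) * (norm x)\<^sup>2"
        by (simp add: power2_eq_square algebra_simps)
      also have "\<dots> \<le> q * (norm x)\<^sup>2"
      proof (rule mult_right_mono)
        have "t * c\<^sup>2 \<le> e" using ce e by (simp add: t_def divide_simps algebra_simps)
        then have "t * (t * c\<^sup>2) \<le> t * e" using t by (intro mult_left_mono) auto
        moreover have "q = 1 - t * e" by (simp add: q_def t_def power2_eq_square)
        ultimately show "1 - 2 * t * e + t * (t * c\<^sup>2) \<le> q" by (simp add: mult.commute)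
      qed simp
      finally show ?thesis .
    qed
    then have nq: "norm (x - t *\<^sub>R Q x) \<le> sqrt q * norm x" for x
      using real_sqrt_le_mono[of "(norm (x - t *\<^sub>R Q x))\<^sup>2" "q * (norm x)\<^sup>2"]
      by (simp add: real_sqrt_mult)
    have lip: "dist (F x) (F z) \<le> sqrt q * dist x z" for x z
      using nq[of "x - z"] by (simp add: dist_norm F_def Q.diff algebra_simps)
    have "\<exists>!x. F x = x"
      by (rule banach_fix_type[of "sqrt q"]) (use q lip in auto)
    then obtain x where "F x = x" by blast
    then have "Q x = y" using t by (simp add: F_def)
    then show ?thesis ..
  qed
  then obtain J where J: "\<And>y. Q (J y) = y" by metis
  have JQ: "J (Q x) = x" for x by (rule inj) (simp add: J)
  have Jn: "norm (e *\<^sub>R J x) \<le> norm x" for x using low'[of "J x"] e by (simp add: J)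
  have "bounded_linear J"
  proof (rule bounded_linear_intro[where K = "1 / e"])
    show "J (x + y) = J x + J y" for x y by (rule inj) (simp add: J Q.add)
    show "J (r *\<^sub>R x) = r *\<^sub>R J x" for r x by (rule inj) (simp add: J Q.scaleR)
    show "norm (J x) \<le> norm x * (1 / e)" for x using Jn[of x] e by (simp add: field_simps)
  qed
  moreover have "rinner (J x) y = rinner x (J y)" for x y
    using Qs[of "J x" "J y"] by (simp add: J)
  ultimately have "self_adjoint J" by (simp add: self_adjoint_def)
  with J JQ Jn show ?thesis by (intro that)
qed

lemma le_of_power_le_const_power:
  fixes q c B :: real
  assumes "\<And>m. q ^ m \<le> B * c ^ m" "0 \<le> c"
  shows "q \<le> c"
proof (rule ccontr)
  assume "\<not> q \<le> c"
  then have qc: "c < q" by simp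
  show False
  proof (cases "c = 0")
    case True
    with assms(1)[of 1] qc show False by simp
  next
    case False
    then have c: "c > 0" using assms by simp
    have "1 < q / c" using qc c by simp
    then obtain m where "B < (q / c) ^ m" using real_arch_pow by blast
    with assms(1)[of m] c show False by (simp add: power_divide field_simps)
  qed
qed

text \<open>The norm of a self-adjoint operator is its spectral radius.\<close>
lemma self_adjoint_norm_le_growth:
  assumes W: "self_adjoint W" and c: "0 \<le> c"
    and growth: "\<And>m. norm ((W ^^ m) u) \<le> B * c ^ m * norm u"
  shows "norm (W u) \<le> c * norm u"
proof (cases "u = 0")
  case True
  then show ?thesis using self_adjoint_bl[OF W] by (simp add: linear_simps)
next
  case False
  define a where "a m = norm ((W ^^ m) u)" for m
  have a0: "a 0 > 0" using False by (simp add: a_def)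
  have logconv: "a (Suc m) * a (Suc m) \<le> a m * a (Suc (Suc m))" for m
  proof -
    have "a (Suc m) * a (Suc m) = rinner ((W ^^ m) u) ((W ^^ Suc (Suc m)) u)"
      by (simp add: a_def power2_eq_square[symmetric] rinner_self[symmetric] self_adjoint_rinner[OF W])
    also have "\<dots> \<le> a m * a (Suc (Suc m))"
      unfolding a_def using rinner_Cauchy_Schwarz abs_le_D1 by blast
    finally show ?thesis .
  qed
  \<comment> \<open>Log-convexity makes the ratios of consecutive terms increase, so the first ratio
    is the smallest; the product form also covers vanishing terms.\<close>
  have step: "a 1 * a m \<le> a 0 * a (Suc m)" for m
  proof (induction m)
    case (Suc m)
    have nn: "a j \<ge> 0" for j by (simp add: a_def)
    show ?case
    proof (cases "a (Suc m) = 0")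
      case False
      have "a 1 * (a (Suc m) * a (Suc m)) \<le> a 1 * (a m * a (Suc (Suc m)))"
        by (intro mult_left_mono logconv nn)
      also have "\<dots> = (a 1 * a m) * a (Suc (Suc m))" by simp
      also have "\<dots> \<le> (a 0 * a (Suc m)) * a (Suc (Suc m))" by (intro mult_right_mono Suc nn)
      finally have "(a 1 * a (Suc m)) * a (Suc m) \<le> (a 0 * a (Suc (Suc m))) * a (Suc m)"
        by (simp add: mult_ac)
      with False nn[of "Suc m"] show ?thesis by (simp add: mult_le_cancel_right)
    qed (simp add: nn)
  qed (simp add: mult.commute)
  have "a 1 / a 0 \<le> c"
  proof (rule le_of_power_le_const_power[OF _ c])
    fix m
    have "(a 1 / a 0) ^ m \<le> a m / a 0"
    proof (induction m)
      case (Suc m)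
      have "(a 1 / a 0) ^ Suc m \<le> (a 1 / a 0) * (a m / a 0)"
        unfolding power_Suc by (rule mult_left_mono[OF Suc]) (simp add: a_def)
      also have "\<dots> \<le> a (Suc m) / a 0" using step[of m] a0 by (simp add: field_simps)
      finally show ?case .
    qed (use a0 in simp)
    also have "\<dots> \<le> B * c ^ m" using growth[of m] a0 by (simp add: a_def field_simps)
    finally show "(a 1 / a 0) ^ m \<le> B * c ^ m" .
  qed
  then show ?thesis using a0 by (simp add: a_def field_simps)
qed

lemma funpow_inverse_cancel: "(\<And>x. f (g x) = x) \<Longrightarrow> (f ^^ k) ((g ^^ k) x) = x"
  for f :: "'b \<Rightarrow> 'b"
  by (induction k arbitrary: x) (simp_all add: funpow_swap1[of f])

text \<open>\<open>W = J\<^sup>k\<^sup>+\<^sup>1 Y J\<^sup>k\<^sup>+\<^sup>1\<close> is similar, via \<open>Q\<close>, to \<open>V = J W Q\<close>, whose norm is at most \<open>c\<close>; hence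
  the spectral radius of the self-adjoint operator \<open>W\<close>, which is its norm, is at most \<open>c\<close>.\<close>
lemma heinz_form_inequality:
  assumes Q: "self_adjoint Q" and J: "self_adjoint J"
    and QJ: "\<And>x. Q (J x) = x" and JQ: "\<And>x. J (Q x) = x"
    and Y: "self_adjoint Y" and c: "0 \<le> c"
    and bound: "\<And>x y. \<bar>rinner (Y x) y\<bar> \<le> c * (norm ((Q ^^ k) x) * norm ((Q ^^ Suc (Suc k)) y))"
  shows "rinner (Y x) x \<le> c * (norm ((Q ^^ Suc k) x))\<^sup>2"
proof -
  note QJk = funpow_inverse_cancel[of Q J, OF QJ] and JQk = funpow_inverse_cancel[of J Q, OF JQ]
  define W where "W u = (J ^^ Suc k) (Y ((J ^^ Suc k) u))" for u
  define V where "V u = (J ^^ Suc (Suc k)) (Y ((J ^^ k) u))" for u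
  have Jk: "bounded_linear (J ^^ j)" for j by (rule bounded_linear_funpow[OF self_adjoint_bl[OF J]])
  have "bounded_linear W"
    unfolding W_def by (intro bounded_linear_compose[OF Jk] bounded_linear_compose[OF self_adjoint_bl[OF Y]] Jk)
  then have W: "self_adjoint W"
    unfolding self_adjoint_def
    by (auto simp del: funpow.simps simp: W_def self_adjoint_funpow_rinner[OF J] self_adjoint_rinner[OF Y])
  have WV: "W u = Q (V (J u))" for u
    by (simp add: W_def V_def QJ funpow_swap1[of J k u])
  \<comment> \<open>Pairing \<open>V u\<close> with itself moves \<open>J ^^ Suc (Suc k)\<close> to
    the other side, and the powers of \<open>Q\<close> in \<open>bound\<close> then cancel those of
    \<open>J\<close>.\<close>
  have Vn: "norm (V u) \<le> c * norm u" for u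
  proof -
    have "(norm (V u))\<^sup>2 = rinner (Y ((J ^^ k) u)) ((J ^^ Suc (Suc k)) (V u))"
      unfolding rinner_self[symmetric]
      by (subst V_def) (rule self_adjoint_funpow_rinner[OF J])
    also have "\<dots> \<le> c * (norm ((Q ^^ k) ((J ^^ k) u)) * norm ((Q ^^ Suc (Suc k)) ((J ^^ Suc (Suc k)) (V u))))"
      using bound abs_le_D1 by blast
    also have "\<dots> = c * norm u * norm (V u)" by (simp only: QJk mult.assoc)
    finally show ?thesis
      by (cases "norm (V u) = 0") (use c in \<open>auto simp: power2_eq_square\<close>)
  qed
  have Wpow: "(W ^^ m) u = Q ((V ^^ m) (J u))" for m u
    by (induction m) (simp_all add: QJ JQ WV)
  have Vpow: "norm ((V ^^ m) u) \<le> c ^ m * norm u" for m u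
  proof (induction m)
    case (Suc m)
    have "norm ((V ^^ Suc m) u) \<le> c * norm ((V ^^ m) u)" by (simp add: Vn)
    also have "\<dots> \<le> c * (c ^ m * norm u)" by (intro mult_left_mono Suc c)
    finally show ?case by simp
  qed simp
  obtain q where q: "q > 0" "\<And>x. norm (Q x) \<le> norm x * q"
    using bounded_linear.pos_bounded[OF self_adjoint_bl[OF Q]] by blast
  obtain j where j: "j > 0" "\<And>x. norm (J x) \<le> norm x * j"
    using bounded_linear.pos_bounded[OF self_adjoint_bl[OF J]] by blast
  \<comment> \<open>The similarity costs a factor \<open>j * q\<close> that is the same for all
    powers, so it does not affect the growth rate.\<close>
  have Wn: "norm (W u) \<le> c * norm u" for u
  proof (rule self_adjoint_norm_le_growth[OF W c])
    fix m
    have "norm ((W ^^ m) u) \<le> norm ((V ^^ m) (J u)) * q" by (simp add: Wpow q)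
    also have "\<dots> \<le> (c ^ m * norm (J u)) * q" using q by (intro mult_right_mono Vpow) simp
    also have "\<dots> \<le> (c ^ m * (norm u * j)) * q"
      using q c by (intro mult_right_mono mult_left_mono j) simp_all
    finally show "norm ((W ^^ m) u) \<le> (j * q) * c ^ m * norm u" by (simp add: mult_ac)
  qed
  define u where "u = (Q ^^ Suc k) x"
  have "rinner (Y x) x = rinner (W u) u"
    unfolding W_def u_def by (simp only: self_adjoint_funpow_rinner[OF J] JQk)
  also have "\<dots> \<le> norm (W u) * norm u" using rinner_Cauchy_Schwarz abs_le_D1 by blast
  also have "\<dots> \<le> c * norm u * norm u" by (intro mult_right_mono Wn) simp
  finally show ?thesis by (simp add: u_def power2_eq_square mult.assoc)
qed

text \<open>A maximum \<open>G > 1\<close> would be attained inside. At the first such index the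
  left neighbour is strictly below \<open>G\<close>, so convexity would give
  \<open>G\<^sup>2 < G\<^sup>2\<close>. Arguing without logarithms allows zero values.\<close>

lemma log_convex_le_one:
  fixes \<gamma> :: "nat \<Rightarrow> real"
  assumes nn: "\<And>k. 0 \<le> \<gamma> k" and ends: "\<gamma> 0 \<le> 1" "\<gamma> N \<le> 1"
    and conv: "\<And>k. Suc (Suc k) \<le> N \<Longrightarrow> (\<gamma> (Suc k))\<^sup>2 \<le> \<gamma> k * \<gamma> (Suc (Suc k))"
    and k: "k \<le> N"
  shows "\<gamma> k \<le> 1"
proof (rule ccontr)
  assume big: "\<not> \<gamma> k \<le> 1"
  define G where "G = Max (\<gamma> ` {..N})"
  have le: "\<gamma> i \<le> G" if "i \<le> N" for i unfolding G_def using that by (intro Max_ge) auto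
  have G: "G > 1" using le[OF k] big by simp
  have "G \<in> \<gamma> ` {..N}" unfolding G_def by (rule Max_in) auto
  then have ex: "\<exists>i. i \<le> N \<and> \<gamma> i = G" by auto
  define i where "i = (LEAST i. i \<le> N \<and> \<gamma> i = G)"
  have i: "i \<le> N" "\<gamma> i = G" using LeastI_ex[OF ex] by (auto simp: i_def)
  have "i \<noteq> 0" "i \<noteq> N" using ends i G not_le by metis+
  then obtain j where j: "i = Suc j" "Suc (Suc j) \<le> N" using i by (cases i) auto
  have "\<gamma> j \<noteq> G" using not_less_Least[of j "\<lambda>i. i \<le> N \<and> \<gamma> i = G"] j i by (auto simp: i_def)
  then have lt: "\<gamma> j < G" using le[of j] j by simp
  have "G\<^sup>2 \<le> \<gamma> j * \<gamma> (Suc (Suc j))" using conv[OF j(2)] i j by simp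
  also have "\<dots> \<le> \<gamma> j * G" by (intro mult_left_mono le j nn)
  also have "\<dots> < G * G" using lt G by simp
  finally show False by (simp add: power2_eq_square)
qed

section \<open>Powers of class A operators\<close>

text \<open>Estimates are proved for the invertible \<open>R + e\<close> and pass to
  \<open>R\<close> as \<open>e\<close> tends to 0.\<close>

lemma funpow_shift_tendsto:
  assumes "bounded_linear R"
  shows "((\<lambda>e. ((\<lambda>x. R x + e *\<^sub>R x) ^^ k) x) \<longlongrightarrow> (R ^^ k) x) (at_right (0::real))"
proof (induction k)
  case (Suc k)
  have "((\<lambda>e. R (((\<lambda>x. R x + e *\<^sub>R x) ^^ k) x) + e *\<^sub>R ((\<lambda>x. R x + e *\<^sub>R x) ^^ k) x)
      \<longlongrightarrow> R ((R ^^ k) x) + 0 *\<^sub>R (R ^^ k) x) (at_right 0)"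
    by (intro tendsto_intros Suc bounded_linear.tendsto[OF assms])
  then show ?case by simp
qed simp

text \<open>\<open>S\<close> will be the square root of \<open>adj T ^^ 2 \<circ> T ^^ 2\<close>,
  and its last assumption is the class A inequality. \<open>RN\<close> is the equality at the right
  end of the range of exponents; at 0 equality is trivial.\<close>

locale class_A_dominated =
  fixes T S R :: "'a::chilbert_space \<Rightarrow> 'a" and N :: nat
  assumes T: "bounded_clinear T"
    and S: "self_adjoint S" "\<And>x. norm (S x) = norm (T (T x))" "\<And>x. (norm (T x))\<^sup>2 \<le> rinner (S x) x"
    and R: "self_adjoint R" "\<And>x. 0 \<le> rinner x (R x)"
    and RN: "\<And>x. norm ((T ^^ N) x) = norm ((R ^^ N) x)"
begin

text \<open>A lower bound for the geometric mean of \<open>T*\<^sup>k T\<^sup>k\<close> and \<open>T*\<^sup>k\<^sup>+\<^sup>2 T\<^sup>k\<^sup>+\<^sup>2\<close>.\<close>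
definition Y :: "nat \<Rightarrow> 'a \<Rightarrow> 'a" where
  "Y k x = (adj T ^^ k) (S ((T ^^ k) x))"

lemma rinner_Y: "rinner (Y k x) y = rinner (S ((T ^^ k) x)) ((T ^^ k) y)"
  unfolding Y_def by (metis adj_funpow_rinner[OF T] rinner_commute)

lemma Y_self_adjoint: "self_adjoint (Y k)"
proof -
  have "bounded_linear (Y k)"
    unfolding Y_def
    by (intro bounded_linear_compose[OF bounded_linear_funpow[OF bounded_clinear_imp_bounded_linear[OF bounded_clinear_adj[OF T]]]]
        bounded_linear_compose[OF self_adjoint_bl[OF S(1)]]
        bounded_linear_funpow[OF bounded_clinear_imp_bounded_linear[OF T]])
  moreover have "rinner (Y k x) y = rinner x (Y k y)" for x y
    by (metis rinner_Y self_adjoint_rinner[OF S(1)] rinner_commute)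
  ultimately show ?thesis by (simp add: self_adjoint_def)
qed

lemma Y_ge: "(norm ((T ^^ Suc k) x))\<^sup>2 \<le> rinner (Y k x) x"
  using S(3)[of "(T ^^ k) x"] by (simp add: rinner_Y)

text \<open>Cauchy-Schwarz, after moving \<open>S\<close> onto \<open>y\<close>, where it has the
  norm of \<open>T \<circ> T\<close>. The uneven split of exponents is the shape that
  \<open>heinz_form_inequality\<close> requires.\<close>

lemma Y_le: "\<bar>rinner (Y k x) y\<bar> \<le> norm ((T ^^ k) x) * norm ((T ^^ Suc (Suc k)) y)"
  using rinner_Cauchy_Schwarz[of "(T ^^ k) x" "S ((T ^^ k) y)"]
  by (simp add: rinner_Y self_adjoint_rinner[OF S(1)] S(2))

text \<open>Positivity of \<open>R\<close> gives the bound for one factor; since \<open>R\<close>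
  commutes with the shift, the factors can be exchanged one at a time.\<close>

lemma norm_R_le_shift:
  assumes e: "e > 0"
  shows "norm ((R ^^ k) x) \<le> norm (((\<lambda>x. R x + e *\<^sub>R x) ^^ k) x)"
proof (induction k arbitrary: x)
  case (Suc k)
  let ?Q = "\<lambda>x. R x + e *\<^sub>R x"
  interpret R: bounded_linear R by (rule self_adjoint_bl[OF R(1)])
  have comm: "(?Q ^^ k) (R x) = R ((?Q ^^ k) x)" for x
    by (induction k) (simp_all add: R.add R.scaleR)
  have ge: "norm (R y) \<le> norm (?Q y)" for y
  proof (rule power2_le_imp_le)
    have "(norm (?Q y))\<^sup>2 = (norm (R y))\<^sup>2 + 2 * e * rinner y (R y) + e\<^sup>2 * (norm y)\<^sup>2"
      unfolding rinner_self[symmetric]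
      by (simp add: rinner_simps rinner_commute[of "R y" y] power2_eq_square algebra_simps)
    then show "(norm (R y))\<^sup>2 \<le> (norm (?Q y))\<^sup>2" using R(2)[of y] e by simp
  qed simp
  have "norm ((R ^^ Suc k) x) = norm ((R ^^ k) (R x))" by (simp add: funpow_swap1)
  also have "\<dots> \<le> norm ((?Q ^^ k) (R x))" by (rule Suc)
  also have "\<dots> \<le> norm (?Q ((?Q ^^ k) x))" by (simp only: comm ge)
  finally show ?case by simp
qed simp

lemma shift_self_adjoint: "self_adjoint (\<lambda>x. R x + e *\<^sub>R x)"
  using R(1) by (auto simp: self_adjoint_def rinner_simps
      intro!: bounded_linear_add bounded_linear_scaleR_right)

text \<open>The optimal constants in \<open>\<parallel>T\<^sup>k x\<parallel> \<le> \<gamma> k * \<parallel>Q\<^sup>k x\<parallel>\<close>, where \<open>Q = R + e\<close>, form a log-convex sequence.\<close>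
lemma norm_funpow_le_shift:
  assumes e: "e > 0" and k: "k \<le> N"
  shows "norm ((T ^^ k) x) \<le> norm (((\<lambda>x. R x + e *\<^sub>R x) ^^ k) x)"
proof -
  define Q where "Q = (\<lambda>x. R x + e *\<^sub>R x)"
  have Q: "self_adjoint Q" unfolding Q_def by (rule shift_self_adjoint)
  obtain J where J: "self_adjoint J" and J': "\<And>x. R (J x) + e *\<^sub>R J x = x"
      "\<And>x. J (R x + e *\<^sub>R x) = x" "\<And>x. norm (e *\<^sub>R J x) \<le> norm x"
    using positive_shift_inverse[OF R e] by blast
  have QJ: "Q (J x) = x" and JQ: "J (Q x) = x" for x by (simp_all add: Q_def J')
  note QJk = funpow_inverse_cancel[of Q J, OF QJ] and JQk = funpow_inverse_cancel[of J Q, OF JQ]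
  \<comment> \<open>Invertibility of \<open>Q\<close> makes these constants finite, which is the
    purpose of the shift by \<open>e\<close>.\<close>
  define \<gamma> where "\<gamma> k = onorm (\<lambda>x. (T ^^ k) ((J ^^ k) x))" for k
  have bl: "bounded_linear (\<lambda>x. (T ^^ k) ((J ^^ k) x))" for k
    by (intro bounded_linear_compose[OF bounded_linear_funpow bounded_linear_funpow]
        bounded_clinear_imp_bounded_linear[OF T] self_adjoint_bl[OF J])
  have nn: "0 \<le> \<gamma> k" for k unfolding \<gamma>_def by (rule onorm_pos_le[OF bl])
  have le: "norm ((T ^^ k) x) \<le> \<gamma> k * norm ((Q ^^ k) x)" for k x
    using onorm[OF bl[of k], of "(Q ^^ k) x"] by (simp only: JQk \<gamma>_def)
  have least: "\<gamma> k \<le> b" if "0 \<le> b" "\<And>x. norm ((T ^^ k) x) \<le> b * norm ((Q ^^ k) x)" for b k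
    unfolding \<gamma>_def by (rule onorm_bound[OF that(1)]) (use that(2)[of "(J ^^ k) x" for x] in \<open>simp only: QJk\<close>)
  \<comment> \<open>\<open>Y_le\<close> with the optimal constants feeds the Heinz inequality with
    \<open>c = ?c\<close>; \<open>Y_ge\<close> turns its conclusion into the bound
    \<open>sqrt ?c\<close> for \<open>\<gamma> (Suc j)\<close>.\<close>
  have conv: "(\<gamma> (Suc j))\<^sup>2 \<le> \<gamma> j * \<gamma> (Suc (Suc j))" for j
  proof -
    let ?c = "\<gamma> j * \<gamma> (Suc (Suc j))"
    have c: "0 \<le> ?c" by (simp add: nn)
    have "\<bar>rinner (Y j x) y\<bar> \<le> ?c * (norm ((Q ^^ j) x) * norm ((Q ^^ Suc (Suc j)) y))" for x y
    proof -
      have "\<bar>rinner (Y j x) y\<bar> \<le> norm ((T ^^ j) x) * norm ((T ^^ Suc (Suc j)) y)" by (rule Y_le)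
      also have "\<dots> \<le> (\<gamma> j * norm ((Q ^^ j) x)) * (\<gamma> (Suc (Suc j)) * norm ((Q ^^ Suc (Suc j)) y))"
        by (intro mult_mono le mult_nonneg_nonneg nn norm_ge_zero)
      finally show ?thesis by (simp only: mult_ac)
    qed
    from heinz_form_inequality[OF Q J QJ JQ Y_self_adjoint c this]
    have "(norm ((T ^^ Suc j) x))\<^sup>2 \<le> ?c * (norm ((Q ^^ Suc j) x))\<^sup>2" for x
      using Y_ge[of j x] by (meson order_trans)
    then have "norm ((T ^^ Suc j) x) \<le> sqrt ?c * norm ((Q ^^ Suc j) x)" for x
      using real_sqrt_le_mono[of "(norm ((T ^^ Suc j) x))\<^sup>2" "?c * (norm ((Q ^^ Suc j) x))\<^sup>2"]
      by (simp add: real_sqrt_mult del: funpow.simps)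
    with c have "\<gamma> (Suc j) \<le> sqrt ?c" by (intro least) (simp del: funpow.simps)+
    then have "(\<gamma> (Suc j))\<^sup>2 \<le> (sqrt ?c)\<^sup>2" by (intro power_mono nn)
    then show ?thesis using c by simp
  qed
  have "\<gamma> 0 \<le> 1" by (rule least) simp_all
  \<comment> \<open>By \<open>RN\<close> the operator \<open>T ^^ N\<close> can be replaced by
    \<open>R ^^ N\<close>, which \<open>Q ^^ N\<close> dominates.\<close>
  moreover have "\<gamma> N \<le> 1"
    by (rule least) (use norm_R_le_shift[OF e, of N] in \<open>simp_all add: RN Q_def\<close>)
  ultimately have "\<gamma> k \<le> 1" by (intro log_convex_le_one[of \<gamma> N k] nn conv k)
  then have "\<gamma> k * norm ((Q ^^ k) x) \<le> 1 * norm ((Q ^^ k) x)" by (rule mult_right_mono) simp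
  with le[of k x] show ?thesis by (simp add: Q_def)
qed

lemma norm_funpow_le:
  assumes "k \<le> N"
  shows "norm ((T ^^ k) x) \<le> norm ((R ^^ k) x)"
proof (rule tendsto_le[OF trivial_limit_at_right_real
      tendsto_norm[OF funpow_shift_tendsto[OF self_adjoint_bl[OF R(1)]]] tendsto_const])
  show "\<forall>\<^sub>F e in at_right 0. norm ((T ^^ k) x) \<le> norm (((\<lambda>x. R x + e *\<^sub>R x) ^^ k) x)"
    using eventually_at_right_less by (rule eventually_mono) (rule norm_funpow_le_shift[OF _ assms])
qed

text \<open>Both neighbours are now bounded by powers of \<open>Q\<close> with constant 1, so the
  Heinz inequality applies with \<open>c = 1\<close>. With \<open>Y_ge\<close> this encloses the
  form of \<open>Y k\<close> between the squared norms of \<open>T ^^ Suc k\<close> and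
  \<open>R ^^ Suc k\<close>.\<close>

lemma Y_form_le:
  assumes k: "Suc (Suc k) \<le> N"
  shows "rinner (Y k x) x \<le> (norm ((R ^^ Suc k) x))\<^sup>2"
proof (rule tendsto_le[OF trivial_limit_at_right_real
      tendsto_power[OF tendsto_norm[OF funpow_shift_tendsto[OF self_adjoint_bl[OF R(1)]]]] tendsto_const])
  have "rinner (Y k x) x \<le> (norm (((\<lambda>x. R x + e *\<^sub>R x) ^^ Suc k) x))\<^sup>2" if e: "0 < e" for e
  proof -
    define Q where "Q = (\<lambda>x. R x + e *\<^sub>R x)"
    have Q: "self_adjoint Q" unfolding Q_def by (rule shift_self_adjoint)
    obtain J where J: "self_adjoint J" and J': "\<And>x. R (J x) + e *\<^sub>R J x = x"
        "\<And>x. J (R x + e *\<^sub>R x) = x" "\<And>x. norm (e *\<^sub>R J x) \<le> norm x"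
      using positive_shift_inverse[OF R e] by blast
    have QJ: "Q (J x) = x" and JQ: "J (Q x) = x" for x by (simp_all add: Q_def J')
    have "\<bar>rinner (Y k x) y\<bar> \<le> 1 * (norm ((Q ^^ k) x) * norm ((Q ^^ Suc (Suc k)) y))" for x y
    proof -
      have "\<bar>rinner (Y k x) y\<bar> \<le> norm ((T ^^ k) x) * norm ((T ^^ Suc (Suc k)) y)" by (rule Y_le)
      also have "\<dots> \<le> norm ((Q ^^ k) x) * norm ((Q ^^ Suc (Suc k)) y)"
        unfolding Q_def using k by (intro mult_mono norm_funpow_le_shift e norm_ge_zero) auto
      finally show ?thesis by simp
    qed
    from heinz_form_inequality[OF Q J QJ JQ Y_self_adjoint zero_le_one this]
    show ?thesis by (simp add: Q_def)
  qed
  then show "\<forall>\<^sub>F e in at_right 0. rinner (Y k x) x \<le> (norm (((\<lambda>x. R x + e *\<^sub>R x) ^^ Suc k) x))\<^sup>2"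
    using eventually_at_right_less by (rule eventually_mono[rotated])
qed

section \<open>Propagation of equality to neighbouring exponents\<close>

text \<open>Equality at \<open>Suc k\<close> closes the enclosure of \<open>Y k\<close>, so
  polarisation identifies it with \<open>R ^^ (2 * Suc k)\<close>; \<open>Y_le\<close> then becomes
  a statement about \<open>R\<close>.\<close>

lemma norm_eq_imp_R_form_le:
  assumes k: "Suc (Suc k) \<le> N" and eq: "\<And>x. norm ((T ^^ Suc k) x) = norm ((R ^^ Suc k) x)"
  shows "\<bar>rinner ((R ^^ k) x) ((R ^^ Suc (Suc k)) y)\<bar> \<le> norm ((T ^^ k) x) * norm ((T ^^ Suc (Suc k)) y)"
proof -
  have "Y k x - (R ^^ (2 * Suc k)) x = 0" for x
  proof (rule self_adjoint_eq_zeroI[where A = "\<lambda>x. Y k x - (R ^^ (2 * Suc k)) x"])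
    show "self_adjoint (\<lambda>x. Y k x - (R ^^ (2 * Suc k)) x)"
      by (rule self_adjoint_diff[OF Y_self_adjoint self_adjoint_funpow[OF R(1)]])
    fix x
    have "rinner (Y k x) x = rinner x ((R ^^ (2 * Suc k)) x)"
      using Y_ge[of k x] Y_form_le[OF k, of x] by (simp only: eq funpow_norm_square[OF R(1)])
    then show "rinner (Y k x - (R ^^ (2 * Suc k)) x) x = 0"
      by (simp only: rinner_diff_left self_adjoint_funpow_rinner[OF R(1)])
  qed
  then have "Y k x = (R ^^ (k + Suc (Suc k))) x" by (simp add: mult_2)
  then have "rinner (Y k x) y = rinner ((R ^^ k) x) ((R ^^ Suc (Suc k)) y)"
    by (metis add.commute funpow_add comp_apply self_adjoint_funpow_rinner[OF R(1)])
  with Y_le[of k x y] show ?thesis by simp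
qed

text \<open>Inserting \<open>R (R x)\<close> in the first slot makes both arguments of the form
  equal to \<open>v\<close>; bounding the factor with \<open>T ^^ k\<close> by \<open>norm v\<close>
  leaves the reverse inequality.\<close>

lemma norm_eq_step_up:
  assumes k: "Suc (Suc k) \<le> N" and eq: "\<And>x. norm ((T ^^ Suc k) x) = norm ((R ^^ Suc k) x)"
  shows "norm ((T ^^ Suc (Suc k)) x) = norm ((R ^^ Suc (Suc k)) x)"
proof (rule antisym)
  show "norm ((T ^^ Suc (Suc k)) x) \<le> norm ((R ^^ Suc (Suc k)) x)" by (rule norm_funpow_le[OF k])
  define v where "v = (R ^^ Suc (Suc k)) x"
  have v: "(R ^^ k) (R (R x)) = v" by (simp add: v_def funpow_swap1)
  have "norm v * norm v \<le> norm ((T ^^ k) (R (R x))) * norm ((T ^^ Suc (Suc k)) x)"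
    using norm_eq_imp_R_form_le[OF assms, of "R (R x)" x]
    by (simp add: v v_def[symmetric] rinner_self power2_eq_square del: funpow.simps)
  also have "\<dots> \<le> norm ((R ^^ k) (R (R x))) * norm ((T ^^ Suc (Suc k)) x)"
    using k by (intro mult_right_mono norm_funpow_le) auto
  finally show "norm ((R ^^ Suc (Suc k)) x) \<le> norm ((T ^^ Suc (Suc k)) x)"
    unfolding v v_def[symmetric] by (cases "norm v = 0") auto
qed

text \<open>Here \<open>k > 0\<close> is needed: only then does \<open>R\<^sup>k x\<close> lie in the closure of the range of \<open>R\<^sup>k\<^sup>+\<^sup>2\<close>;
  the approximants are \<open>R\<^sup>k\<^sup>+\<^sup>2 (R + e)\<^sup>-\<^sup>2 x\<close>.\<close>
lemma norm_eq_step_down: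
  assumes k: "Suc (Suc k) \<le> N" "k > 0" and eq: "\<And>x. norm ((T ^^ Suc k) x) = norm ((R ^^ Suc k) x)"
  shows "norm ((T ^^ k) x) = norm ((R ^^ k) x)"
proof (rule antisym)
  show "norm ((T ^^ k) x) \<le> norm ((R ^^ k) x)" using k by (intro norm_funpow_le) simp
  interpret R: bounded_linear R by (rule self_adjoint_bl[OF R(1)])
  interpret Rk: bounded_linear "R ^^ j" for j by (rule bounded_linear_funpow[OF R.bounded_linear_axioms])
  obtain j where j: "k = Suc j" using k by (cases k) auto
  define w where "w = (R ^^ k) x"
  \<comment> \<open>Below, \<open>P = R J = 1 - e J\<close> has norm at most 2, and 6 = 2 + 4
    accounts for \<open>P z\<close> and \<open>P (P z)\<close>.\<close>
  define b where "b = 6 * norm ((R ^^ j) x)"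
  have approx: "\<exists>y. norm ((R ^^ Suc (Suc k)) y - w) \<le> e * b" if e: "e > 0" for e
  proof -
    obtain J where J: "self_adjoint J" and QJ: "\<And>x. R (J x) + e *\<^sub>R J x = x"
        and JQ: "\<And>x. J (R x + e *\<^sub>R x) = x" and Jn: "\<And>x. norm (e *\<^sub>R J x) \<le> norm x"
      using positive_shift_inverse[OF R e] by blast
    interpret J: bounded_linear J by (rule self_adjoint_bl[OF J])
    have JR: "J (R x) = R (J x)" for x
      using JQ[of x] QJ[of x] by (simp add: J.add J.scaleR) (metis add_right_cancel)
    have comm: "(R ^^ i) (J x) = J ((R ^^ i) x)" for i x by (induction i) (simp_all add: JR)
    define z where "z = (R ^^ j) x"
    have w: "w = R z" by (simp add: w_def z_def j)
    define P where "P y = R (J y)" for y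
    have P: "P y = y - e *\<^sub>R J y" for y using QJ[of y] by (simp add: P_def algebra_simps)
    have Pn: "norm (P y) \<le> 2 * norm y" for y
      using norm_triangle_ineq4[of y "e *\<^sub>R J y"] Jn[of y] by (simp add: P)
    \<comment> \<open>Here \<open>k > 0\<close> enters: writing \<open>w = R z\<close> keeps
      \<open>J w\<close> bounded independently of \<open>e\<close>, so the error
      \<open>P (P w) - w\<close> is of order \<open>e\<close>.\<close>
    have JRz: "J w = P z" by (simp add: w P_def JR)
    have "J (P w) = P (P z)" by (simp add: P_def w JR)
    then have "P (P w) = w - e *\<^sub>R P z - e *\<^sub>R P (P z)"
      using P[of "P w"] P[of w] JRz by simp
    then have "P (P w) - w = - (e *\<^sub>R (P z + P (P z)))" by (simp add: algebra_simps)
    then have "norm (P (P w) - w) = e * norm (P z + P (P z))"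
      using e by (simp only: norm_minus_cancel norm_scaleR abs_of_pos)
    also have "\<dots> \<le> e * b"
      using norm_triangle_ineq[of "P z" "P (P z)"] Pn[of z] Pn[of "P z"] e
      by (intro mult_left_mono) (simp_all add: b_def z_def)
    finally have "norm (P (P w) - w) \<le> e * b" .
    moreover have "(R ^^ Suc (Suc k)) (J (J x)) = P (P w)"
      by (simp add: w_def comm P_def JR)
    ultimately show ?thesis by metis
  qed
  define t where "t = norm ((T ^^ k) x)"
  have "norm w * norm w \<le> t * norm w"
  proof (rule field_le_epsilon)
    fix d :: real assume d: "0 < d"
    \<comment> \<open>Collects the errors of replacing \<open>norm v\<close> by
      \<open>norm w\<close> and \<open>v\<close> by \<open>w\<close>; the 1 added in the denominator
      of \<open>e\<close> covers \<open>C = 0\<close>.\<close>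
    define C where "C = b * (t + norm w)"
    have C: "C \<ge> 0" by (simp add: C_def b_def t_def)
    define e where "e = d / (C + 1)"
    have e: "e > 0" "e * C \<le> d" using d C by (auto simp: e_def field_simps)
    obtain y where y: "norm ((R ^^ Suc (Suc k)) y - w) \<le> e * b" using approx[OF e(1)] by blast
    define v where "v = (R ^^ Suc (Suc k)) y"
    have vw: "norm (w - v) \<le> e * b" using y by (simp add: v_def norm_minus_commute)
    have "\<bar>rinner w v\<bar> \<le> t * norm ((T ^^ Suc (Suc k)) y)"
      using norm_eq_imp_R_form_le[OF k(1) eq, of x y] by (simp only: w_def v_def t_def)
    also have "\<dots> \<le> t * norm v"
      unfolding v_def t_def by (intro mult_left_mono norm_funpow_le k norm_ge_zero)
    also have "\<dots> \<le> t * (norm w + e * b)"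
      using norm_triangle_ineq4[of w "w - v"] vw by (intro mult_left_mono) (auto simp: t_def)
    finally have 1: "rinner w v \<le> t * (norm w + e * b)" by simp
    have "rinner w (w - v) \<le> norm w * norm (w - v)" using rinner_Cauchy_Schwarz abs_le_D1 by blast
    also have "\<dots> \<le> norm w * (e * b)" by (intro mult_left_mono vw) simp
    finally have 2: "rinner w (w - v) \<le> norm w * (e * b)" .
    have "norm w * norm w = rinner w v + rinner w (w - v)"
      by (simp add: rinner_simps rinner_self power2_eq_square)
    also have "\<dots> \<le> t * norm w + e * C" using 1 2 by (simp add: C_def algebra_simps)
    finally show "norm w * norm w \<le> t * norm w + d" using e by simp
  qed
  then show "norm ((R ^^ k) x) \<le> norm ((T ^^ k) x)"
    unfolding w_def[symmetric] t_def[symmetric] by (cases "norm w = 0") (auto simp: t_def)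
qed

text \<open>Descends from \<open>n\<close> to exponent 1, where \<open>norm_eq_step_down\<close> has
  to stop, and climbs again to 2 and 3.\<close>

lemma norm_eq_one_two_three:
  assumes n: "1 < n" "n < N" and N: "4 \<le> N" and eq: "\<And>x. norm ((T ^^ n) x) = norm ((R ^^ n) x)"
  shows "\<forall>x. norm (T x) = norm (R x)" "\<forall>x. norm ((T ^^ 2) x) = norm ((R ^^ 2) x)"
    "\<forall>x. norm ((T ^^ 3) x) = norm ((R ^^ 3) x)"
proof -
  have "\<forall>x. norm ((T ^^ Suc i) x) = norm ((R ^^ Suc i) x)" if "i < n" for i
    using that
  proof (induction "n - Suc i" arbitrary: i)
    case 0
    then have "Suc i = n" by simp
    with eq show ?case by (simp only: simp_thms)
  next
    case (Suc d)
    then have "d = n - Suc (Suc i)" "Suc i < n" by auto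
    note IH = Suc.hyps(1)[OF this]
    show ?case
    proof
      show "norm ((T ^^ Suc i) x) = norm ((R ^^ Suc i) x)" for x
        by (rule norm_eq_step_down[OF _ _ IH[rule_format]]) (use \<open>Suc i < n\<close> n in simp_all)
    qed
  qed
  from this[of 0] n have 1: "norm ((T ^^ Suc 0) x) = norm ((R ^^ Suc 0) x)" for x by simp
  have 2: "norm ((T ^^ Suc (Suc 0)) x) = norm ((R ^^ Suc (Suc 0)) x)" for x
    by (rule norm_eq_step_up[OF _ 1]) (use N in simp)
  have 3: "norm ((T ^^ Suc (Suc (Suc 0))) x) = norm ((R ^^ Suc (Suc (Suc 0))) x)" for x
    by (rule norm_eq_step_up[OF _ 2]) (use N in simp)
  show "\<forall>x. norm (T x) = norm (R x)" using 1 by simp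
  show "\<forall>x. norm ((T ^^ 2) x) = norm ((R ^^ 2) x)" using 2 by (simp only: numeral_2_eq_2 simp_thms)
  show "\<forall>x. norm ((T ^^ 3) x) = norm ((R ^^ 3) x)" using 3 by (simp only: numeral_3_eq_3 simp_thms)
qed

end

section \<open>From equalities of norms to quasinormality\<close>

lemma adj_funpow_comp_eq:
  fixes T :: "'a::chilbert_space \<Rightarrow> 'a"
  assumes T: "bounded_clinear T" and R: "self_adjoint R"
    and eq: "\<forall>x. norm ((T ^^ k) x) = norm ((R ^^ k) x)"
  shows "(adj T ^^ k) ((T ^^ k) x) = (R ^^ (2 * k)) x"
proof -
  have Tk: "bounded_clinear (T ^^ k)" by (rule bounded_clinear_funpow[OF T])
  have "self_adjoint (adj T ^^ k \<circ> T ^^ k)"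
    using self_adjoint_adj_comp[OF Tk] by (simp add: adj_funpow[OF T])
  then have "self_adjoint (\<lambda>x. (adj T ^^ k \<circ> T ^^ k) x - (R ^^ (2 * k)) x)"
    by (rule self_adjoint_diff[OF _ self_adjoint_funpow[OF R]])
  then have "(adj T ^^ k \<circ> T ^^ k) x - (R ^^ (2 * k)) x = 0"
  proof (rule self_adjoint_eq_zeroI)
    fix x
    have "rinner x ((adj T ^^ k) ((T ^^ k) x)) = (norm ((T ^^ k) x))\<^sup>2"
      by (simp add: adj_funpow_rinner[OF T, symmetric] rinner_self)
    also have "\<dots> = rinner x ((R ^^ (2 * k)) x)"
      using eq by (simp add: funpow_norm_square[OF R])
    finally show "rinner ((adj T ^^ k \<circ> T ^^ k) x - (R ^^ (2 * k)) x) x = 0"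
      by (simp add: rinner_diff_right rinner_commute[of _ x])
  qed
  then show ?thesis by simp
qed

text \<open>With \<open>D = T*T\<close> one has \<open>T*DT = D\<^sup>2\<close> and \<open>T*D\<^sup>2T = D\<^sup>3\<close>, so that
  \<open>(DT - TD)*(DT - TD) = D\<^sup>3 - 2 D\<^sup>3 + D\<^sup>3 = 0\<close>.\<close>
lemma quasinormalI:
  fixes T :: "'a::chilbert_space \<Rightarrow> 'a"
  assumes T: "bounded_clinear T" and R: "self_adjoint R"
    and 1: "\<forall>x. norm (T x) = norm (R x)" and 2: "\<forall>x. norm ((T ^^ 2) x) = norm ((R ^^ 2) x)"
    and 3: "\<forall>x. norm ((T ^^ 3) x) = norm ((R ^^ 3) x)"
  shows "quasinormal T"
proof -
  define D where "D x = R (R x)" for x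
  have Ds: "rinner (D x) y = rinner x (D y)" for x y by (simp add: D_def self_adjoint_rinner[OF R])
  have TT: "adj T (T x) = D x" for x
    using adj_funpow_comp_eq[OF T R, of 1 x] 1 by (simp add: D_def numeral_2_eq_2)
  \<comment> \<open>In \<open>T*\<^sup>2 T\<^sup>2 = D\<^sup>2\<close> the inner product
    \<open>T* T\<close> collapses to \<open>D\<close>; \<open>TDDT\<close> peels the third powers in
    the same way.\<close>
  have TDT: "adj T (D (T x)) = D (D x)" for x
    using adj_funpow_comp_eq[OF T R 2, of x] by (simp add: eval_nat_numeral TT) (simp add: D_def)
  have TDDT: "adj T (D (D (T x))) = D (D (D x))" for x
    using adj_funpow_comp_eq[OF T R 3, of x] by (simp add: eval_nat_numeral TT TDT) (simp add: D_def)
  have "T (D x) = D (T x)" for x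
  proof -
    have a: "rinner (T u) v = rinner u (adj T v)" for u v by (rule adj_rinner(1)[OF T])
    have "(norm (T (D x) - D (T x)))\<^sup>2 =
        rinner (T (D x)) (T (D x)) - 2 * rinner (T (D x)) (D (T x)) + rinner (D (T x)) (D (T x))"
      unfolding rinner_self[symmetric] by (simp add: rinner_simps rinner_commute[of "D (T x)" "T (D x)"])
    also have "\<dots> = 0"
      by (simp add: a Ds TT TDT TDDT)
    finally show ?thesis by simp
  qed
  then show ?thesis by (simp add: quasinormal_def fun_eq_iff TT)
qed

theorem theorem4p3:
  fixes T :: "'a::chilbert_space \<Rightarrow> 'a" and n \<kappa> :: nat
  assumes "bounded_clinear T"
    and "class_A T"
    and "n > 1" and "\<kappa> > 1"
    and "(adj (T ^^ n) ^^ \<kappa>) \<circ> ((T ^^ n) ^^ \<kappa>) = (adj (T ^^ n) \<circ> (T ^^ n)) ^^ \<kappa>"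
  shows "quasinormal T"
proof -
  note T = assms(1)
  have T2: "bounded_clinear (T ^^ 2)" and X: "bounded_clinear (T ^^ n)"
    by (rule bounded_clinear_funpow[OF T])+
  define S where "S = op_sqrt (adj (T ^^ 2) \<circ> T ^^ 2)"
  note S = op_sqrt_properties[OF T2, folded S_def]
  have Ssa: "self_adjoint S" by (rule positive_op_self_adjoint[OF S(1,2)])
  have Snorm: "norm (S x) = norm (T (T x))" for x
  proof -
    have "(norm (S x))\<^sup>2 = rinner x ((S \<circ> S) x)"
      by (simp add: rinner_self[symmetric] self_adjoint_rinner[OF Ssa])
    also have "\<dots> = (norm (T (T x)))\<^sup>2"
      unfolding S(3) rinner_self[symmetric]
      by (simp add: adj_rinner(1)[OF T2, symmetric]) (simp add: numeral_2_eq_2)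
    finally show ?thesis by (simp add: power2_eq_iff_nonneg)
  qed
  have Sge: "(norm (T x))\<^sup>2 \<le> rinner (S x) x" for x
  proof -
    have "positive_op (\<lambda>x. S x - (adj T \<circ> T) x)"
      using assms(2) by (simp add: class_A_def op_le_def S_def adj_funpow[OF T])
    from positive_op_rinner[OF this, of x] show ?thesis
      by (simp add: rinner_simps adj_rinner(1)[OF T, symmetric] rinner_self rinner_commute[of x "S x"])
  qed
  \<comment> \<open>The exponent \<open>2 * n\<close> makes \<open>R\<close> the square root of the
    \<open>n\<close>-th root of \<open>X* X\<close>.\<close>
  obtain R where R: "self_adjoint R" "\<And>x. 0 \<le> rinner x (R x)"
      "R ^^ (2 * n) = adj (T ^^ n) \<circ> T ^^ n"
    using positive_root_exists[OF X, of "2 * n"] assms(3) by auto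
  have eq_n: "norm ((T ^^ n) x) = norm ((R ^^ n) x)" for x
  proof -
    have "(norm ((R ^^ n) x))\<^sup>2 = rinner x ((adj (T ^^ n) \<circ> T ^^ n) x)"
      by (simp only: funpow_norm_square[OF R(1)] R(3))
    also have "\<dots> = (norm ((T ^^ n) x))\<^sup>2"
      by (simp add: adj_rinner(1)[OF X, symmetric] rinner_self)
    finally show ?thesis by (simp add: power2_eq_iff_nonneg)
  qed
  have eq_N: "norm ((T ^^ (n * \<kappa>)) x) = norm ((R ^^ (n * \<kappa>)) x)" for x
  proof -
    \<comment> \<open>The hypothesis on \<open>X = T ^^ n\<close> enters here, turning
      \<open>(X* X)\<^sup>\<kappa>\<close> into
      \<open>X*\<^sup>\<kappa> X\<^sup>\<kappa>\<close>.\<close>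
    have "(norm ((R ^^ (n * \<kappa>)) x))\<^sup>2 = rinner x (((R ^^ (2 * n)) ^^ \<kappa>) x)"
      by (simp only: funpow_norm_square[OF R(1)] funpow_mult mult_ac)
    also have "\<dots> = rinner x (((adj (T ^^ n) ^^ \<kappa>) \<circ> ((T ^^ n) ^^ \<kappa>)) x)"
      by (simp only: R(3) assms(5))
    also have "\<dots> = (norm (((T ^^ n) ^^ \<kappa>) x))\<^sup>2"
      by (simp add: adj_funpow_rinner[OF X, symmetric] rinner_self)
    finally show ?thesis by (simp add: power2_eq_iff_nonneg funpow_mult)
  qed
  interpret class_A_dominated T S R "n * \<kappa>"
    by (unfold_locales; fact T Ssa Snorm Sge R eq_N)
  \<comment> \<open>\<open>\<kappa> > 1\<close> makes \<open>n\<close> an interior exponent, so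
    equality there can spread.\<close>
  have N: "n < n * \<kappa>" "4 \<le> n * \<kappa>"
    using assms(3,4) mult_le_mono[of 2 n 2 \<kappa>] by auto
  show ?thesis
    by (rule quasinormalI[OF T R(1) norm_eq_one_two_three[OF assms(3) N eq_n]])
qed

end
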